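(* Let $\mathcal{H},\mathcal{K}$ be Hilbert spaces, let $V\in\mathcal{B}(\mathcal{H})$ be a pure isometry (a unilateral shift), let $T\in\mathcal{B}(\mathcal{K})$ be a right invertible contraction, and for $Y\in\mathcal{B}(\mathcal{H},\mathcal{K})$ write $$R(Y)=\begin{bmatrix}T & Y\\ 0 & V\end{bmatrix}\in\mathcal{B}(\mathcal{K}\oplus\mathcal{H}),$$ so $R(0)=T\oplus V$. Let $X\in\mathcal{B}(\mathcal{H},\mathcal{K})$. Then $R(X)$ is similar to a contraction if and only if there exist $A\in\mathcal{B}(\mathcal{H},\mathcal{K})$ and a nilpotent $E\in\mathcal{B}(\mathcal{K}\oplus\mathcal{H})$ with $ER(A)=0$ and $R(X)=R(A)+E$, such that $R(A)$ is quadratically near $R(0)$ modulo $\ker V^*$, i.e. there is a constant $s$ with $$\Big\|\sum_{n=0}^{N}\big(R(A)^n-R(0)^n\big)x_n\Big\|\le s\Big(\sum_{n=0}^N\|x_n\|^2\Big)^{1/2}$$ for every $N\in\mathbb{N}$ and all $x_0,\ldots,x_N\in\{0\}\oplus\ker V^*\subset\mathcal{K}\oplus\mathcal{H}$.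
   Context: An operator is similar to a contraction if it is conjugate by an invertible operator to an operator of norm at most 1. *)

theory Defs
  imports "HOL-Analysis.Analysis"
begin

class complex_vector = real_vector +
  fixes scaleC :: "complex \<Rightarrow> 'a \<Rightarrow> 'a"
  assumes scaleC_of_real: "scaleC (of_real r) x = scaleR r x"
    and scaleC_add_right: "scaleC a (x + y) = scaleC a x + scaleC a y"
    and scaleC_add_left: "scaleC (a + b) x = scaleC a x + scaleC b x"
    and scaleC_scaleC: "scaleC a (scaleC b x) = scaleC (a * b) x"
    and scaleC_one: "scaleC 1 x = x"

class complex_normed_vector = complex_vector + real_normed_vector +
  assumes norm_scaleC: "norm (scaleC a x) = cmod a * norm x"

class complex_hilbert = complex_normed_vector + complete_space +
  fixes cinner :: "'a \<Rightarrow> 'a \<Rightarrow> complex"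
  assumes cinner_commute: "cinner x y = cnj (cinner y x)"
    and cinner_add_left: "cinner (x + y) z = cinner x z + cinner y z"
    and cinner_scaleC_left: "cinner (scaleC r x) y = cnj r * cinner x y"
    and cinner_self_real: "Im (cinner x x) = 0"
    and norm_eq_sqrt_cinner: "norm x = sqrt (Re (cinner x x))"

text \<open>The direct sum K \<oplus> H is modelled by the product type (with the norm
  sqrt(norm k^2 + norm h^2) from HOL-Analysis); complex scalars act componentwise.\<close>
instantiation prod :: (complex_vector, complex_vector) complex_vector
begin
definition scaleC_prod_def: "scaleC c x = (scaleC c (fst x), scaleC c (snd x))"
instance
  by standard (auto simp: scaleC_prod_def scaleC_of_real scaleC_add_right
      scaleC_add_left scaleC_scaleC scaleC_one scaleR_prod_def)
end

definition bounded_clinear :: "('a::complex_normed_vector \<Rightarrow> 'b::complex_normed_vector) \<Rightarrow> bool" where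
  "bounded_clinear f \<longleftrightarrow>
     (\<forall>x y. f (x + y) = f x + f y) \<and> (\<forall>c x. f (scaleC c x) = scaleC c (f x)) \<and>
     (\<exists>K. \<forall>x. norm (f x) \<le> norm x * K)"

definition bounded_clinear_sum ::
  "('k::complex_normed_vector \<times> 'h::complex_normed_vector \<Rightarrow> 'k \<times> 'h) \<Rightarrow> bool" where
  "bounded_clinear_sum f \<longleftrightarrow>
     (\<forall>x y. f (x + y) = f x + f y) \<and> (\<forall>c x. f (scaleC c x) = scaleC c (f x)) \<and>
     (\<exists>K. \<forall>x. norm (f x) \<le> norm x * K)"

definition cadjoint :: "('a::complex_hilbert \<Rightarrow> 'b::complex_hilbert) \<Rightarrow> 'b \<Rightarrow> 'a" where
  "cadjoint V = (THE W. \<forall>x y. cinner (V x) y = cinner x (W y))"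

definition isometry :: "('a::complex_hilbert \<Rightarrow> 'a) \<Rightarrow> bool" where
  "isometry V \<longleftrightarrow> bounded_clinear V \<and> (\<forall>x. norm (V x) = norm x)"

text \<open>Pure isometry (unilateral shift): an isometry with no unitary part,
  i.e. \<Inter>n V^n(H) = {0} (Wold decomposition).\<close>
definition pure_isometry :: "('a::complex_hilbert \<Rightarrow> 'a) \<Rightarrow> bool" where
  "pure_isometry V \<longleftrightarrow> isometry V \<and> (\<Inter>n. range (V ^^ n)) = {0}"

definition contraction :: "('a::complex_normed_vector \<Rightarrow> 'a) \<Rightarrow> bool" where
  "contraction T \<longleftrightarrow> bounded_clinear T \<and> (\<forall>x. norm (T x) \<le> norm x)"

definition right_invertible :: "('a::complex_normed_vector \<Rightarrow> 'a) \<Rightarrow> bool" where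
  "right_invertible T \<longleftrightarrow> bounded_clinear T \<and> (\<exists>S. bounded_clinear S \<and> T \<circ> S = id)"

definition similar_to_contraction ::
  "('k::complex_normed_vector \<times> 'h::complex_normed_vector \<Rightarrow> 'k \<times> 'h) \<Rightarrow> bool" where
  "similar_to_contraction M \<longleftrightarrow>
     (\<exists>S Sinv. bounded_clinear_sum S \<and> bounded_clinear_sum Sinv \<and>
        S \<circ> Sinv = id \<and> Sinv \<circ> S = id \<and>
        bounded_clinear_sum (S \<circ> M \<circ> Sinv) \<and>
        (\<forall>x. norm ((S \<circ> M \<circ> Sinv) x) \<le> norm x))"

definition nilpotent :: "('a \<Rightarrow> 'a::zero) \<Rightarrow> bool" where
  "nilpotent E \<longleftrightarrow> (\<exists>n. (E ^^ n) = (\<lambda>_. 0))"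

definition opR :: "('k \<Rightarrow> 'k) \<Rightarrow> ('h \<Rightarrow> 'h) \<Rightarrow> ('h \<Rightarrow> 'k::plus) \<Rightarrow> 'k \<times> 'h \<Rightarrow> 'k \<times> 'h" where
  "opR T V Y = (\<lambda>(k, h). (T k + Y h, V h))"

end

theory Submission
  imports Defs
begin

text \<open>
  Since \<open>E = R(X) - R(A)\<close> has only the corner \<open>X - A\<close>, the condition \<open>E R(A) = 0\<close> says \<open>X V = A V\<close>, and
  nilpotency is automatic. The corner of \<open>R(A)\<^sup>n\<close> is \<open>A\<^sub>n = \<Sum>\<^sub>i\<^sub>+\<^sub>j\<^sub>=\<^sub>n\<^sub>-\<^sub>1 T\<^sup>i A V\<^sup>j\<close>.

  If \<open>R(A)\<close> is quadratically near \<open>R(0)\<close>, then \<open>L (V\<^sup>n y) = A\<^sub>n y\<close> for \<open>y \<in> ker V*\<close> defines a bounded operator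
  with \<open>L V = T L + A\<close>. With a right inverse \<open>S\<close> of \<open>T\<close>, the operator \<open>L - S (X - A)\<close> solves the same equation
  for \<open>X\<close>, so \<open>R(X)\<close> is similar to \<open>R(0)\<close>.

  Conversely, let \<open>C\<close> be a contraction similar to \<open>R(X)\<close>, let \<open>p\<close> be the induced surjection onto \<open>H\<close>, so that
  \<open>p C = V p\<close>, and choose \<open>c > 0\<close> with \<open>p p* \<ge> 2c\<close>. A lurking-isometry argument, as in the Toeplitz corona
  theorem, turns the identity \<open>\<Gamma> + c (1 - V V*) = V \<Gamma> V* + p (1 - C C*) p*\<close>, where \<open>\<Gamma> = p p* - c\<close>, into a
  bounded \<open>\<Phi>\<close> with \<open>\<Phi> p* = 1\<close> and \<open>c \<Sum>\<^sub>n \<parallel>P \<Phi> C*\<^sup>n m\<parallel>\<^sup>2 \<le> \<parallel>m\<parallel>\<^sup>2\<close>, where \<open>P = 1 - V V*\<close>. Its adjoint \<open>r\<close> is a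
  right inverse of \<open>p\<close> for which \<open>\<Sum>\<^sub>n C\<^sup>n r y\<^sub>n\<close> is square bounded on \<open>ker V*\<close>. In the coordinates of \<open>R(X)\<close> this
  lifting reads \<open>y \<mapsto> (l y, y)\<close>, and \<open>A = X + T l P\<close> is the required perturbation, because
  \<open>A\<^sub>n y = T\<^sup>n l y + X\<^sub>n y\<close> for \<open>n \<ge> 1\<close> and \<open>y \<in> ker V*\<close>.
\<close>

section \<open>Real inner products, adjoints and coercive operators\<close>

text \<open>The argument runs over the reals, where \<open>bounded_linear\<close> and its library
  apply; the real part of the inner product determines the norm and the adjoints. Complex linearity
  is restored afterwards by \<open>clinear_part\<close>.\<close>

definition rinner :: "'a::complex_hilbert \<Rightarrow> 'a \<Rightarrow> real" (infix "\<bullet>\<^sub>r" 70) where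
  "x \<bullet>\<^sub>r y = Re (cinner x y)"

lemma rinner_self: "x \<bullet>\<^sub>r x = (norm x)\<^sup>2"
proof -
  have "sqrt (Re (cinner x x)) \<ge> 0"
    using norm_eq_sqrt_cinner[of x] by (metis norm_ge_zero)
  then show ?thesis
    by (simp add: rinner_def norm_eq_sqrt_cinner)
qed

instance prod :: (complex_normed_vector, complex_normed_vector) complex_normed_vector
proof
  fix a :: complex and x :: "'a \<times> 'b"
  have "norm (scaleC a x) = sqrt ((cmod a)\<^sup>2 * ((norm (fst x))\<^sup>2 + (norm (snd x))\<^sup>2))"
    by (simp add: scaleC_prod_def norm_Pair norm_scaleC power_mult_distrib distrib_left)
  then show "norm (scaleC a x) = cmod a * norm x"
    by (simp add: real_sqrt_mult norm_prod_def)
qed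

text \<open>Makes the direct sum a Hilbert space, so that the lifting lemmas apply to a contraction
  acting on it.\<close>

instantiation prod :: (complex_hilbert, complex_hilbert) complex_hilbert
begin

definition cinner_prod_def: "cinner x y = cinner (fst x) (fst y) + cinner (snd x) (snd y)"

instance
proof
  fix x y z :: "'a \<times> 'b" and r :: complex
  show "cinner x y = cnj (cinner y x)"
    unfolding cinner_prod_def by (subst (1 2) cinner_commute) simp
  show "cinner (x + y) z = cinner x z + cinner y z"
    by (simp add: cinner_prod_def cinner_add_left)
  show "cinner (scaleC r x) y = cnj r * cinner x y"
    by (simp add: cinner_prod_def scaleC_prod_def cinner_scaleC_left distrib_left)
  show "Im (cinner x x) = 0"
    by (simp add: cinner_prod_def cinner_self_real)
  show "norm x = sqrt (Re (cinner x x))"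
    by (simp add: cinner_prod_def rinner_self[unfolded rinner_def] norm_prod_def)
qed

end

section \<open>Algebra of the real inner product and the Cauchy-Schwarz inequality\<close>

lemma rinner_commute: "x \<bullet>\<^sub>r y = y \<bullet>\<^sub>r x"
  unfolding rinner_def by (subst cinner_commute) simp

lemma rinner_add_left: "(x + y) \<bullet>\<^sub>r z = x \<bullet>\<^sub>r z + y \<bullet>\<^sub>r z"
  by (simp add: rinner_def cinner_add_left)

lemma rinner_scaleR_left: "(a *\<^sub>R x) \<bullet>\<^sub>r y = a * (x \<bullet>\<^sub>r y)"
  by (simp add: rinner_def cinner_scaleC_left flip: scaleC_of_real)

lemma rinner_add_right: "x \<bullet>\<^sub>r (y + z) = x \<bullet>\<^sub>r y + x \<bullet>\<^sub>r z"
  by (metis rinner_add_left rinner_commute)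

lemma rinner_scaleR_right: "x \<bullet>\<^sub>r (a *\<^sub>R y) = a * (x \<bullet>\<^sub>r y)"
  by (metis rinner_scaleR_left rinner_commute)

lemma rinner_le_norm: "\<bar>x \<bullet>\<^sub>r y\<bar> \<le> norm x * norm y"
proof (cases "norm y = 0")
  case True
  then have "y = 0 *\<^sub>R y" by simp
  then show ?thesis by (metis True rinner_scaleR_right abs_0 mult_zero_left mult_zero_right order_refl)
next
  case False
  then have y: "norm y > 0" by simp
  let ?t = "(x \<bullet>\<^sub>r y) / (norm y)\<^sup>2"
  have expand: "(x + s *\<^sub>R y) \<bullet>\<^sub>r (x + s *\<^sub>R y) = (norm x)\<^sup>2 + 2 * s * (x \<bullet>\<^sub>r y) + s\<^sup>2 * (norm y)\<^sup>2" for s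
    by (simp only: rinner_add_left rinner_add_right rinner_scaleR_left rinner_scaleR_right
        rinner_self[of x] rinner_self[of y] rinner_commute[of y x]) (simp add: power2_eq_square algebra_simps)
  have "0 \<le> (x + (-?t) *\<^sub>R y) \<bullet>\<^sub>r (x + (-?t) *\<^sub>R y)"
    unfolding rinner_self by simp
  also have "\<dots> = (norm x)\<^sup>2 - (x \<bullet>\<^sub>r y)\<^sup>2 / (norm y)\<^sup>2"
    unfolding expand using y by (simp add: power2_eq_square field_simps)
  finally have "(x \<bullet>\<^sub>r y)\<^sup>2 \<le> (norm x * norm y)\<^sup>2"
    using y by (simp add: field_simps power_mult_distrib)
  then show ?thesis
    by (metis abs_le_square_iff abs_mult abs_norm_cancel)
qed

lemma bounded_bilinear_rinner: "bounded_bilinear ((\<bullet>\<^sub>r) :: 'a::complex_hilbert \<Rightarrow> 'a \<Rightarrow> real)"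
proof
  show "\<exists>K. \<forall>a b :: 'a. norm (a \<bullet>\<^sub>r b) \<le> norm a * norm b * K"
    by (rule exI[of _ 1]) (simp add: rinner_le_norm)
qed (simp_all add: rinner_add_left rinner_add_right rinner_scaleR_left rinner_scaleR_right)

interpretation rinner: bounded_bilinear "(\<bullet>\<^sub>r)"
  by (rule bounded_bilinear_rinner)

lemmas rinner_simps = rinner.add_left rinner.add_right rinner.diff_left rinner.diff_right
  rinner.minus_left rinner.minus_right rinner.scaleR_left rinner.scaleR_right

section \<open>Norm expansions, the Riesz representation and adjoints\<close>

lemma norm_add_sq: "(norm (x + y))\<^sup>2 = (norm x)\<^sup>2 + 2 * (x \<bullet>\<^sub>r y) + (norm y)\<^sup>2"
  unfolding rinner_self[symmetric] by (simp add: rinner_simps rinner_commute)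

lemma norm_diff_sq: "(norm (x - y))\<^sup>2 = (norm x)\<^sup>2 - 2 * (x \<bullet>\<^sub>r y) + (norm y)\<^sup>2"
  unfolding rinner_self[symmetric] by (simp add: rinner_simps rinner_commute)

lemma rinner_eq_zeroD: "(\<And>x. x \<bullet>\<^sub>r y = 0) \<Longrightarrow> y = 0"
  using rinner_self[of y] by simp

lemma rinner_eqI: "(\<And>x. x \<bullet>\<^sub>r y = x \<bullet>\<^sub>r z) \<Longrightarrow> y = z"
  using rinner_eq_zeroD[of "y - z"] by (simp add: rinner_simps)

text \<open>Meant for \<open>a n\<close> the square norm of the \<open>n\<close>-th iterate of a
  contraction at a fixed vector, a decreasing and hence convergent sequence.\<close>

lemma Cauchy_if_norm_sq_le:
  fixes x :: "nat \<Rightarrow> 'a::real_normed_vector" and a :: "nat \<Rightarrow> real"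
  assumes "Cauchy a" and "\<And>m n. m \<le> n \<Longrightarrow> (norm (x m - x n))\<^sup>2 \<le> K * \<bar>a m - a n\<bar>"
  shows "Cauchy x"
proof (rule CauchyI)
  fix e :: real
  assume e: "e > 0"
  \<comment> \<open>\<open>K\<close> may be nonpositive; the maximum with 1 allows division.\<close>
  define K' where "K' = max K 1"
  have K': "K' > 0" "K \<le> K'" by (auto simp: K'_def)
  have "e\<^sup>2 / K' > 0" using e K' by simp
  then obtain M where M: "\<And>m n. m \<ge> M \<Longrightarrow> n \<ge> M \<Longrightarrow> norm (a m - a n) < e\<^sup>2 / K'"
    using CauchyD[OF assms(1)] by meson
  have *: "norm (x m - x n) < e" if "m \<ge> M" "n \<ge> M" "m \<le> n" for m n
  proof -
    have "(norm (x m - x n))\<^sup>2 \<le> K' * \<bar>a m - a n\<bar>"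
      using assms(2)[OF that(3)] K'(2) by (meson abs_ge_zero mult_right_mono order_trans)
    also have "\<dots> < K' * (e\<^sup>2 / K')"
      using M[OF that(1,2)] K' by (intro mult_strict_left_mono) auto
    also have "\<dots> = e\<^sup>2" using K' by simp
    finally show ?thesis
      using e by (simp add: power_less_imp_less_base)
  qed
  show "\<exists>M. \<forall>m\<ge>M. \<forall>n\<ge>M. norm (x m - x n) < e"
    by (metis * nat_le_linear norm_minus_commute)
qed

text \<open>The representing vector minimises \<open>J\<close>: a minimising sequence is Cauchy by
  the parallelogram law, and the first variation vanishes at its limit.\<close>

lemma riesz_representation:
  fixes f :: "'a::complex_hilbert \<Rightarrow> real"
  assumes f: "bounded_linear f"
  obtains z where "\<And>x. f x = x \<bullet>\<^sub>r z"
proof -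
  interpret f: bounded_linear f by (rule f)
  obtain K where K: "\<And>x. norm (f x) \<le> norm x * K"
    using f.bounded by blast
  define J where "J x = (norm x)\<^sup>2 - 2 * f x" for x
  have J_lower: "J x \<ge> - K\<^sup>2" for x
  proof -
    have "f x \<le> norm x * K" using K[of x] by simp
    moreover have "0 \<le> (norm x - K)\<^sup>2" by simp
    ultimately show ?thesis by (simp add: J_def power2_diff)
  qed
  define \<mu> where "\<mu> = Inf (range J)"
  have bdd: "bdd_below (range J)" using J_lower by (auto intro!: bdd_belowI)
  have mu: "\<mu> \<le> J x" for x unfolding \<mu>_def using bdd by (simp add: cINF_lower)
  have "\<exists>x. J x < \<mu> + inverse (real (Suc n))" for n
    using cInf_lessD[of "range J" "\<mu> + inverse (real (Suc n))"] by (auto simp: \<mu>_def)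
  then obtain x where x: "\<And>n. J (x n) < \<mu> + inverse (real (Suc n))" by metis
  have par: "(norm (u - v))\<^sup>2 \<le> 2 * J u + 2 * J v - 4 * \<mu>" for u v
  proof -
    \<comment> \<open>At the midpoint the linear terms on both sides agree, which leaves the
      parallelogram law.\<close>
    define w where "w = (1/2) *\<^sub>R (u + v)"
    have "(norm (u - v))\<^sup>2 + 4 * J w = 2 * J u + 2 * J v"
      unfolding J_def w_def by (simp add: f.scaleR f.add power_mult_distrib norm_add_sq norm_diff_sq
          power_divide rinner_simps algebra_simps)
    then show ?thesis using mu[of w] by linarith
  qed
  have "Cauchy x"
  proof (rule CauchyI)
    fix e :: real
    assume e: "e > 0"
    then obtain M where M: "inverse (real (Suc M)) < e\<^sup>2 / 4"
      using reals_Archimedean[of "e\<^sup>2 / 4"] by auto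
    have *: "J (x n) < \<mu> + e\<^sup>2 / 4" if "n \<ge> M" for n
    proof -
      have "inverse (real (Suc n)) \<le> inverse (real (Suc M))" using that by simp
      then show ?thesis using x[of n] M by linarith
    qed
    have "norm (x m - x n) < e" if "m \<ge> M" "n \<ge> M" for m n
    proof -
      have "(norm (x m - x n))\<^sup>2 < e\<^sup>2"
        using par[of "x m" "x n"] *[OF that(1)] *[OF that(2)] by linarith
      then show ?thesis using e by (simp add: power_less_imp_less_base)
    qed
    then show "\<exists>M. \<forall>m\<ge>M. \<forall>n\<ge>M. norm (x m - x n) < e" by blast
  qed
  then obtain z where z: "x \<longlonglongrightarrow> z" using Cauchy_convergent convergent_def by blast
  have "(\<lambda>n. J (x n)) \<longlonglongrightarrow> J z"
    unfolding J_def by (intro tendsto_intros f.tendsto z)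
  moreover have "(\<lambda>n. \<mu> + inverse (real (Suc n))) \<longlonglongrightarrow> \<mu> + 0"
    by (intro tendsto_intros LIMSEQ_inverse_real_of_nat)
  ultimately have "J z \<le> \<mu>"
    using LIMSEQ_le[of "\<lambda>n. J (x n)" "J z" "\<lambda>n. \<mu> + inverse (real (Suc n))" "\<mu> + 0"] x
    by (auto simp: less_imp_le)
  then have Jz: "J z \<le> J u" for u using mu[of u] by linarith
  have "f y = y \<bullet>\<^sub>r z" for y
  proof (rule ccontr)
    assume ne: "f y \<noteq> y \<bullet>\<^sub>r z"
    define \<delta> where "\<delta> = f y - y \<bullet>\<^sub>r z"
    \<comment> \<open>A step along \<open>y\<close> that lowers \<open>J\<close> below its minimum;
      the \<open>+ 1\<close> keeps the denominator positive for every \<open>y\<close>.\<close>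
    define t where "t = \<delta> / ((norm y)\<^sup>2 + 1)"
    have pos: "(norm y)\<^sup>2 + 1 > 0" by (simp add: add_nonneg_pos)
    have "J (z + t *\<^sub>R y) = J z - 2 * t * \<delta> + t\<^sup>2 * (norm y)\<^sup>2"
      by (simp add: J_def norm_add_sq f.add f.scaleR rinner_simps rinner_commute[of z y] \<delta>_def
          power_mult_distrib algebra_simps)
    moreover have "t\<^sup>2 * (norm y)\<^sup>2 \<le> t * \<delta>"
    proof -
      have "t\<^sup>2 * (norm y)\<^sup>2 \<le> t\<^sup>2 * ((norm y)\<^sup>2 + 1)" by (intro mult_left_mono) auto
      also have "\<dots> = t * \<delta>" using pos by (simp add: t_def power2_eq_square)
      finally show ?thesis .
    qed
    moreover have "t * \<delta> > 0"
      using ne pos by (simp add: t_def \<delta>_def flip: power2_eq_square)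
    ultimately show False using Jz[of "z + t *\<^sub>R y"] by linarith
  qed
  then show thesis by (rule that)
qed

text \<open>Real linearity suffices. Riesz gives \<open>f' y\<close> for each \<open>y\<close>, and
  testing with \<open>x = f' y\<close> transfers the bound of \<open>f\<close>.\<close>

lemma hilbert_adjoint:
  fixes f :: "'a::complex_hilbert \<Rightarrow> 'b::complex_hilbert"
  assumes f: "bounded_linear f"
  obtains f' where "bounded_linear f'" and "\<And>x y. f x \<bullet>\<^sub>r y = x \<bullet>\<^sub>r f' y"
proof -
  interpret f: bounded_linear f by (rule f)
  have "\<exists>z. \<forall>x. f x \<bullet>\<^sub>r y = x \<bullet>\<^sub>r z" for y
    by (rule riesz_representation[OF bounded_linear_compose[OF rinner.bounded_linear_left f]]) blast
  then obtain f' where f': "\<And>x y. f x \<bullet>\<^sub>r y = x \<bullet>\<^sub>r f' y" by metis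
  obtain K where K: "\<And>x. norm (f x) \<le> norm x * K" and "K \<ge> 0"
    using f.nonneg_bounded by blast
  have "bounded_linear f'"
  proof (rule bounded_linear_intro)
    show "f' (x + y) = f' x + f' y" for x y
      by (rule rinner_eqI) (simp add: rinner_simps f'[symmetric])
    show "f' (r *\<^sub>R x) = r *\<^sub>R f' x" for r x
      by (rule rinner_eqI) (simp add: rinner_simps f'[symmetric])
    show "norm (f' x) \<le> norm x * K" for x
    proof (cases "norm (f' x) = 0")
      case True
      then show ?thesis using \<open>K \<ge> 0\<close> by simp
    next
      case False
      have "norm (f' x) * norm (f' x) = f (f' x) \<bullet>\<^sub>r x"
        by (simp add: f' rinner_self flip: power2_eq_square)
      also have "\<dots> \<le> norm (f (f' x)) * norm x" using rinner_le_norm abs_le_iff by blast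
      also have "\<dots> \<le> norm (f' x) * K * norm x" by (intro mult_right_mono K) simp
      finally have "norm (f' x) * norm (f' x) \<le> norm (f' x) * (norm x * K)"
        by (simp add: mult_ac)
      then show ?thesis using False by (simp add: mult_le_cancel_left)
    qed
  qed
  then show thesis using f' by (rule that)
qed

text \<open>For small \<open>t\<close> the map \<open>x \<mapsto> x - t (G x - y)\<close> is a strict contraction.\<close>

lemma coercive_inverse:
  fixes G :: "'a::complex_hilbert \<Rightarrow> 'a"
  assumes G: "bounded_linear G" and c: "c > 0"
    and coer: "\<And>x. c * (norm x)\<^sup>2 \<le> G x \<bullet>\<^sub>r x"
  obtains G' where "bounded_linear G'" and "\<And>y. G (G' y) = y" and "\<And>x. G x = 0 \<Longrightarrow> x = 0"
proof -
  interpret G: bounded_linear G by (rule G)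
  obtain M where M: "\<And>x. norm (G x) \<le> norm x * M" and "M > 0"
    using G.pos_bounded by blast
  have inj: "x = 0" if "G x = 0" for x
    using coer[of x] that c by (simp add: rinner.zero_left mult_le_0_iff)
  have lower: "c * norm x \<le> norm (G x)" for x
  proof (cases "norm x = 0")
    case False
    have "c * norm x * norm x \<le> norm (G x) * norm x"
      using coer[of x] rinner_le_norm[of "G x" x] by (simp add: power2_eq_square mult_ac)
    then show ?thesis using False by (simp add: mult_le_cancel_right)
  qed (use c in simp)
  \<comment> \<open>\<open>M'\<close> dominates both \<open>M\<^sup>2\<close> and
    \<open>c\<^sup>2\<close>, so that \<open>q\<close> is real and below 1;
    \<open>t = c / M'\<close> minimises the bound \<open>1 - 2 t c + t\<^sup>2 M'\<close> for the
    squared contraction factor.\<close>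
  define M' where "M' = M\<^sup>2 + c\<^sup>2"
  have M': "M' > 0" "M\<^sup>2 \<le> M'" "c\<^sup>2 \<le> M'" using \<open>M > 0\<close> by (auto simp: M'_def add_pos_nonneg)
  define t where "t = c / M'"
  define q where "q = sqrt (1 - c\<^sup>2 / M')"
  have q: "0 \<le> q" "q < 1" "q\<^sup>2 = 1 - c\<^sup>2 / M'" using M' c by (auto simp: q_def)
  have contr: "norm (x - t *\<^sub>R G x) \<le> q * norm x" for x
  proof -
    have "(norm (x - t *\<^sub>R G x))\<^sup>2 = (norm x)\<^sup>2 - 2 * t * (G x \<bullet>\<^sub>r x) + t\<^sup>2 * (norm (G x))\<^sup>2"
      by (simp add: norm_diff_sq rinner_simps rinner_commute power_mult_distrib)
    also have "\<dots> \<le> (norm x)\<^sup>2 - 2 * t * (c * (norm x)\<^sup>2) + t\<^sup>2 * ((norm x)\<^sup>2 * M')"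
    proof -
      have "2 * t * (c * (norm x)\<^sup>2) \<le> 2 * t * (G x \<bullet>\<^sub>r x)"
        using coer[of x] c M' by (intro mult_left_mono) (auto simp: t_def)
      moreover have "(norm (G x))\<^sup>2 \<le> (norm x)\<^sup>2 * M\<^sup>2"
        using power_mono[OF M[of x], of 2] by (simp add: power_mult_distrib)
      then have "(norm (G x))\<^sup>2 \<le> (norm x)\<^sup>2 * M'"
        using M'(2) by (meson mult_left_mono order_trans zero_le_power2)
      then have "t\<^sup>2 * (norm (G x))\<^sup>2 \<le> t\<^sup>2 * ((norm x)\<^sup>2 * M')"
        by (intro mult_left_mono) auto
      ultimately show ?thesis by linarith
    qed
    also have "\<dots> = (1 - c\<^sup>2 / M') * (norm x)\<^sup>2"
      using M'(1) by (simp add: t_def power2_eq_square field_simps)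
    also have "\<dots> = (q * norm x)\<^sup>2"
      by (simp only: power_mult_distrib q(3))
    finally show ?thesis
      by (rule power2_le_imp_le) (use q(1) in simp)
  qed
  have "\<exists>x. G x = y" for y
  proof -
    have "\<exists>!x. x - t *\<^sub>R (G x - y) = x"
    proof (rule banach_fix_type[OF q(1,2)], intro allI)
      show "dist (u - t *\<^sub>R (G u - y)) (v - t *\<^sub>R (G v - y)) \<le> q * dist u v" for u v
        using contr[of "u - v"] by (simp add: dist_norm G.diff algebra_simps)
    qed
    then obtain x where "x - t *\<^sub>R (G x - y) = x" by blast
    then have "t *\<^sub>R (G x - y) = 0" by (metis diff_eq_eq add_cancel_right_right)
    then show ?thesis using c M' by (auto simp: t_def)
  qed
  then obtain G' where G': "\<And>y. G (G' y) = y" by metis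
  have eqI: "u = v" if "G u = G v" for u v
    using inj[of "u - v"] that by (simp add: G.diff)
  have "bounded_linear G'"
  proof (rule bounded_linear_intro)
    show "G' (x + y) = G' x + G' y" for x y by (rule eqI) (simp add: G.add G')
    show "G' (r *\<^sub>R x) = r *\<^sub>R G' x" for r x by (rule eqI) (simp add: G.scaleR G')
    show "norm (G' x) \<le> norm x * inverse c" for x
      using lower[of "G' x"] c by (simp add: G' field_simps)
  qed
  then show thesis using G' inj by (rule that)
qed

section \<open>Powers and adjoints of contractions\<close>

lemma bounded_linear_funpow:
  fixes f :: "'a::real_normed_vector \<Rightarrow> 'a"
  shows "bounded_linear f \<Longrightarrow> bounded_linear (f ^^ n)"
proof (induction n)
  case 0
  then show ?case by (simp add: bounded_linear_ident id_def)
next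
  case (Suc n)
  then show ?case using bounded_linear_compose[of f "f ^^ n"] by (simp add: o_def)
qed

lemma adjoint_funpow:
  fixes f f' :: "'a::complex_hilbert \<Rightarrow> 'a"
  assumes "\<And>x y. f x \<bullet>\<^sub>r y = x \<bullet>\<^sub>r f' y"
  shows "(f ^^ n) x \<bullet>\<^sub>r y = x \<bullet>\<^sub>r (f' ^^ n) y"
proof (induction n arbitrary: x y)
  case (Suc n)
  then show ?case using assms by (simp add: funpow_swap1)
qed simp

lemma norm_funpow:
  fixes f :: "'a::real_normed_vector \<Rightarrow> 'a"
  shows "(\<And>x. norm (f x) = norm x) \<Longrightarrow> norm ((f ^^ n) x) = norm x"
  by (induction n) auto

lemma Cauchy_norm_sq_funpow:
  fixes f :: "'a::real_normed_vector \<Rightarrow> 'a"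
  assumes "\<And>x. norm (f x) \<le> norm x"
  shows "Cauchy (\<lambda>n. (norm ((f ^^ n) x))\<^sup>2)"
proof -
  have "decseq (\<lambda>n. (norm ((f ^^ n) x))\<^sup>2)"
    using assms by (simp add: decseq_Suc_iff power_mono)
  then have "convergent (\<lambda>n. (norm ((f ^^ n) x))\<^sup>2)"
    using decseq_convergent[of _ 0] by (metis convergent_def zero_le_power2)
  then show ?thesis by (rule convergent_Cauchy)
qed

lemma adjoint_contraction:
  fixes f :: "'a::complex_hilbert \<Rightarrow> 'b::complex_hilbert"
  assumes "\<And>x. norm (f x) \<le> norm x" and adj: "\<And>x y. f x \<bullet>\<^sub>r y = x \<bullet>\<^sub>r f' y"
  shows "norm (f' y) \<le> norm y"
proof (cases "norm (f' y) = 0")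
  case False
  have "norm (f' y) * norm (f' y) = f (f' y) \<bullet>\<^sub>r y"
    by (simp add: adj rinner_self flip: power2_eq_square)
  also have "\<dots> \<le> norm (f (f' y)) * norm y" using rinner_le_norm abs_le_iff by blast
  also have "\<dots> \<le> norm (f' y) * norm y" by (intro mult_right_mono assms) simp
  finally show ?thesis using False by (simp add: mult_le_cancel_left)
qed simp

section \<open>Pure isometries\<close>

text \<open>The adjoint \<open>Vs\<close> is a parameter with its defining property, so that the
  definite description in \<open>cadjoint\<close> is resolved once, in
  \<open>pure_isometry_shift\<close>.\<close>

locale shift =
  fixes V Vs :: "'h::complex_hilbert \<Rightarrow> 'h"
  assumes V: "bounded_linear V" and norm_V: "\<And>x. norm (V x) = norm x"
    and pure: "(\<Inter>n. range (V ^^ n)) = {0}"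
    and Vs: "bounded_linear Vs" and adj: "\<And>x y. V x \<bullet>\<^sub>r y = x \<bullet>\<^sub>r Vs y"
begin

interpretation V: bounded_linear V by (rule V)
interpretation Vs: bounded_linear Vs by (rule Vs)

lemma isometry_inner: "V x \<bullet>\<^sub>r V y = x \<bullet>\<^sub>r y"
  using norm_add_sq[of x y] norm_add_sq[of "V x" "V y"] norm_V by (simp flip: V.add)

lemma Vs_V [simp]: "Vs (V x) = x"
  by (rule rinner_eqI) (simp add: isometry_inner flip: adj)

lemma Vs_V_funpow [simp]: "(Vs ^^ n) ((V ^^ n) x) = x"
proof (induction n arbitrary: x)
  case (Suc n)
  show ?case unfolding funpow_Suc_right[of n Vs] by (simp add: Suc)
qed simp

lemma norm_Vs: "norm (Vs x) \<le> norm x"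
  by (rule adjoint_contraction[OF _ adj]) (simp add: norm_V)

text \<open>The orthogonal projection onto the kernel of \<open>Vs\<close>, the wandering subspace
  of \<open>V\<close>.\<close>

definition defect :: "'h \<Rightarrow> 'h" where "defect x = x - V (Vs x)"

lemma bounded_linear_defect: "bounded_linear defect"
  unfolding defect_def
  by (intro bounded_linear_sub bounded_linear_ident bounded_linear_compose[OF V] Vs)

lemma defect_V [simp]: "defect (V x) = 0"
  by (simp add: defect_def)

lemma Vs_defect [simp]: "Vs (defect x) = 0"
  by (simp add: defect_def Vs.diff)

lemma defect_kernel: "Vs y = 0 \<Longrightarrow> defect y = y"
  by (simp add: defect_def V.zero)

lemma norm_defect_sq: "(norm (defect x))\<^sup>2 = (norm x)\<^sup>2 - (norm (Vs x))\<^sup>2"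
  unfolding defect_def norm_diff_sq norm_V
  by (simp add: rinner_commute[of x "V (Vs x)"] adj rinner_self)

lemma kernel_inner_defect: "Vs y = 0 \<Longrightarrow> y \<bullet>\<^sub>r defect x = y \<bullet>\<^sub>r x"
  by (simp add: defect_def rinner_simps rinner_commute[of y "V (Vs x)"] adj rinner.zero_right)

text \<open>The finite Wold decomposition; the sum telescopes.\<close>

lemma sum_shifted_defects: "(\<Sum>n<N. (V ^^ n) (defect ((Vs ^^ n) x))) = x - (V ^^ N) ((Vs ^^ N) x)"
proof (induction N)
  case (Suc N)
  interpret VN: bounded_linear "V ^^ N" by (rule bounded_linear_funpow[OF V])
  show ?case
    unfolding sum.lessThan_Suc Suc by (simp add: defect_def VN.diff funpow_swap1)
qed simp

lemma range_projection_comp: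
  assumes "k \<le> n"
  shows "(Vs ^^ k) ((V ^^ n) x) = (V ^^ (n - k)) x"
proof -
  have "(V ^^ n) x = (V ^^ k) ((V ^^ (n - k)) x)"
    using assms by (metis funpow_add comp_apply le_add_diff_inverse)
  then show ?thesis by simp
qed

text \<open>These vectors are the projections of \<open>x\<close> onto the decreasing ranges of
  \<open>V ^^ n\<close>. They converge, the limit lies in every range, and purity makes it
  zero.\<close>

lemma range_projection_tendsto_0: "(\<lambda>n. (V ^^ n) ((Vs ^^ n) x)) \<longlonglongrightarrow> 0"
proof -
  let ?P = "\<lambda>n. (V ^^ n) ((Vs ^^ n) x)"
  let ?a = "\<lambda>n. (norm ((Vs ^^ n) x))\<^sup>2"
  \<comment> \<open>The projections are nested, which turns the square distance of two terms into a
    difference of values of \<open>?a\<close>.\<close>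
  have inner: "?P m \<bullet>\<^sub>r ?P n = ?a n" if "m \<le> n" for m n
  proof -
    have "?P m \<bullet>\<^sub>r ?P n = (Vs ^^ m) x \<bullet>\<^sub>r (V ^^ (n - m)) ((Vs ^^ n) x)"
      by (simp add: adjoint_funpow[OF adj] range_projection_comp[OF that])
    also have "\<dots> = (Vs ^^ (n - m)) ((Vs ^^ m) x) \<bullet>\<^sub>r (Vs ^^ n) x"
      by (metis adjoint_funpow[OF adj] rinner_commute)
    also have "\<dots> = ?a n"
      using that by (metis funpow_add comp_apply le_add_diff_inverse2 rinner_self)
    finally show ?thesis .
  qed
  have "Cauchy ?P"
  proof (rule Cauchy_if_norm_sq_le[OF Cauchy_norm_sq_funpow[OF norm_Vs]])
    show "(norm (?P m - ?P n))\<^sup>2 \<le> 1 * \<bar>?a m - ?a n\<bar>" if "m \<le> n" for m n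
      using inner[OF that] by (simp add: norm_diff_sq norm_funpow[OF norm_V])
  qed
  then obtain z where z: "?P \<longlonglongrightarrow> z" using Cauchy_convergent convergent_def by blast
  \<comment> \<open>From index \<open>k\<close> on, the terms are fixed by the continuous projection
    onto the range of \<open>V ^^ k\<close>, and so is their limit.\<close>
  have "z \<in> range (V ^^ k)" for k
  proof -
    interpret Vk: bounded_linear "V ^^ k" by (rule bounded_linear_funpow[OF V])
    interpret Vsk: bounded_linear "Vs ^^ k" by (rule bounded_linear_funpow[OF Vs])
    have "(\<lambda>n. (V ^^ k) ((Vs ^^ k) (?P n))) \<longlonglongrightarrow> (V ^^ k) ((Vs ^^ k) z)"
      by (intro Vk.tendsto Vsk.tendsto z)
    moreover have "(V ^^ k) ((Vs ^^ k) (?P n)) = ?P n" if "k \<le> n" for n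
      unfolding range_projection_comp[OF that]
      using that by (metis funpow_add comp_apply le_add_diff_inverse)
    then have "eventually (\<lambda>n. (V ^^ k) ((Vs ^^ k) (?P n)) = ?P n) sequentially"
      by (auto simp: eventually_sequentially)
    ultimately have "?P \<longlonglongrightarrow> (V ^^ k) ((Vs ^^ k) z)"
      by (rule Lim_transform_eventually)
    then have "z = (V ^^ k) ((Vs ^^ k) z)" using z LIMSEQ_unique by blast
    then show ?thesis by blast
  qed
  then have "z = 0" using pure by blast
  then show ?thesis using z by simp
qed

lemma Vs_funpow_tendsto_0: "(\<lambda>n. (Vs ^^ n) x) \<longlonglongrightarrow> 0"
proof (rule tendsto_norm_zero_cancel)
  show "(\<lambda>n. norm ((Vs ^^ n) x)) \<longlonglongrightarrow> 0"
    using tendsto_norm_zero[OF range_projection_tendsto_0[of x]] by (simp add: norm_funpow[OF norm_V])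
qed

end

text \<open>Multiplication by \<open>\<i>\<close> is skew for the real inner product and commutes
  with \<open>V\<close>, hence with the real adjoint. As the imaginary part of
  \<open>cinner x y\<close> is the real inner product of \<open>scaleC \<i> x\<close> and
  \<open>y\<close>, the real adjoint is also the complex one.\<close>

lemma pure_isometry_shift:
  fixes V :: "'h::complex_hilbert \<Rightarrow> 'h"
  assumes "pure_isometry V"
  obtains Vs where "shift V Vs" and "cadjoint V = Vs"
    and "\<And>x. Vs (scaleC \<i> x) = scaleC \<i> (Vs x)"
proof -
  have lin: "\<And>x y. V (x + y) = V x + V y" "\<And>a x. V (scaleC a x) = scaleC a (V x)"
    and iso: "\<And>x. norm (V x) = norm x" and pure: "(\<Inter>n. range (V ^^ n)) = {0}"
    using assms unfolding pure_isometry_def isometry_def bounded_clinear_def by auto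
  have V: "bounded_linear V"
    by (rule bounded_linear_intro[of _ 1]) (auto simp: lin iso simp flip: scaleC_of_real)
  obtain Vs where Vs: "bounded_linear Vs" "\<And>x y. V x \<bullet>\<^sub>r y = x \<bullet>\<^sub>r Vs y"
    using hilbert_adjoint[OF V] by blast
  have skew: "scaleC \<i> x \<bullet>\<^sub>r y = - (x \<bullet>\<^sub>r scaleC \<i> y)" for x y :: 'h
    unfolding rinner_def cinner_commute[of x] by (simp add: cinner_scaleC_left cinner_commute[of y x])
  have Vs_i: "Vs (scaleC \<i> y) = scaleC \<i> (Vs y)" for y
  proof (rule rinner_eqI)
    fix x
    have "x \<bullet>\<^sub>r Vs (scaleC \<i> y) = - (V (scaleC \<i> x) \<bullet>\<^sub>r y)"
      unfolding lin skew[of "V x"] Vs(2)[symmetric] by simp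
    also have "\<dots> = x \<bullet>\<^sub>r scaleC \<i> (Vs y)"
      unfolding Vs(2) skew by simp
    finally show "x \<bullet>\<^sub>r Vs (scaleC \<i> y) = x \<bullet>\<^sub>r scaleC \<i> (Vs y)" .
  qed
  have im: "Im (cinner x y) = scaleC \<i> x \<bullet>\<^sub>r y" for x y :: 'h
    by (simp add: rinner_def cinner_scaleC_left)
  have cadj: "cinner (V x) y = cinner x (Vs y)" for x y
  proof (rule complex_eqI)
    show "Re (cinner (V x) y) = Re (cinner x (Vs y))"
      using Vs(2) by (simp add: rinner_def)
    show "Im (cinner (V x) y) = Im (cinner x (Vs y))"
      unfolding im by (simp flip: lin Vs(2))
  qed
  have "cadjoint V = Vs"
    unfolding cadjoint_def
  proof (rule the_equality)
    fix W
    assume W: "\<forall>x y. cinner (V x) y = cinner x (W y)"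
    show "W = Vs"
      by (intro ext rinner_eqI) (metis W cadj rinner_def)
  qed (use cadj in blast)
  moreover have "shift V Vs"
    by (rule shift.intro[OF V iso pure Vs])
  ultimately show thesis using that Vs_i by blast
qed

section \<open>Lifting along a surjective intertwiner\<close>

context shift
begin

interpretation V: bounded_linear V by (rule V)
interpretation Vs: bounded_linear Vs by (rule Vs)

text \<open>\<open>\<Phi>\<close> solves \<open>\<Phi> m = A (\<Phi> (Cs m)) + B m\<close> and is
  found by iteration. Convergence, the bound and the square sum all come from the inequality
  \<open>energy\<close> for \<open>A\<close> and \<open>B\<close>.\<close>

lemma square_summable_left_inverse:
  fixes C Cs :: "'m::complex_hilbert \<Rightarrow> 'm" and p :: "'m \<Rightarrow> 'h" and ps :: "'h \<Rightarrow> 'm"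
  assumes C: "bounded_linear C" and Cs: "bounded_linear Cs"
    and C_adj: "\<And>x y. C x \<bullet>\<^sub>r y = x \<bullet>\<^sub>r Cs y" and norm_Cs: "\<And>m. norm (Cs m) \<le> norm m"
    and p: "bounded_linear p" and ps: "bounded_linear ps"
    and p_adj: "\<And>x y. p x \<bullet>\<^sub>r y = x \<bullet>\<^sub>r ps y"
    and inter: "\<And>h. Cs (ps h) = ps (Vs h)"
    and c: "c > 0" and lower: "\<And>h. 2 * c * (norm h)\<^sup>2 \<le> (norm (ps h))\<^sup>2"
  obtains \<Phi> where "bounded_linear \<Phi>" and "\<And>h. \<Phi> (ps h) = h"
    and "\<And>N m. c * (\<Sum>n<N. (norm (defect (\<Phi> ((Cs ^^ n) m))))\<^sup>2) \<le> (norm m)\<^sup>2"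
proof -
  interpret C: bounded_linear C by (rule C)
  interpret Cs: bounded_linear Cs by (rule Cs)
  interpret p: bounded_linear p by (rule p)
  interpret ps: bounded_linear ps by (rule ps)
  \<comment> \<open>The quadratic form of \<open>\<Gamma> = p ps - c\<close>; the factor 2 in
    \<open>lower\<close> leaves it coercive.\<close>
  define g where "g h = (norm (ps h))\<^sup>2 - c * (norm h)\<^sup>2" for h
  have g_lower: "c * (norm h)\<^sup>2 \<le> g h" for h
    using lower[of h] by (simp add: g_def)
  have g_nonneg: "0 \<le> g h" for h
    using g_lower[of h] c by (meson mult_nonneg_nonneg order_trans less_imp_le zero_le_power2)
  have g_upper: "g h \<le> (norm (ps h))\<^sup>2" for h
    using c by (simp add: g_def)
  \<comment> \<open>\<open>G\<close> is \<open>\<Gamma> + c P\<close> with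
    \<open>P = defect\<close>. By \<open>inter\<close> it also equals
    \<open>V \<Gamma> Vs + p (1 - C Cs) ps\<close>, the pullback of the form on pairs along
    \<open>u \<mapsto> (Vs u, ps u)\<close>.\<close>
  define G where "G h = p (ps h) - c *\<^sub>R V (Vs h)" for h
  have G: "bounded_linear G"
    unfolding G_def by (intro bounded_linear_sub bounded_linear_compose[OF p ps]
        bounded_linear_compose[OF bounded_linear_scaleR_right] bounded_linear_compose[OF V Vs])
  interpret G: bounded_linear G by (rule G)
  have G_inner: "G h \<bullet>\<^sub>r k = ps h \<bullet>\<^sub>r ps k - c * (Vs h \<bullet>\<^sub>r Vs k)" for h k
    by (simp add: G_def rinner_simps adj p_adj)
  have G_self: "G u \<bullet>\<^sub>r u = g u + c * (norm (defect u))\<^sup>2" for u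
    unfolding G_inner g_def norm_defect_sq by (simp add: rinner_self algebra_simps)
  have coer: "c * (norm u)\<^sup>2 \<le> G u \<bullet>\<^sub>r u" for u
    unfolding G_self using g_lower[of u] c by (simp add: add_increasing2)
  obtain G' where G': "bounded_linear G'" and GG': "\<And>y. G (G' y) = y"
    and G_inj: "\<And>x. G x = 0 \<Longrightarrow> x = 0"
    using coercive_inverse[OF G c coer] by blast
  interpret G': bounded_linear G' by (rule G')
  \<comment> \<open>The lurking isometry: \<open>A h + B m\<close> is the element \<open>u\<close> for which \<open>(V* u, p* u)\<close> is the best approximation
    of \<open>(h, m)\<close> in the form \<open>g(h) + \<parallel>m\<parallel>\<^sup>2 - \<parallel>C* m\<parallel>\<^sup>2\<close>; this projection is contractive.\<close>
  define A where "A h = G' (V (p (ps h) - c *\<^sub>R h))" for h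
  define B where "B m = G' (p (m - C (Cs m)))" for m
  have A: "bounded_linear A"
    unfolding A_def by (intro bounded_linear_compose[OF G'] bounded_linear_compose[OF V]
        bounded_linear_sub bounded_linear_compose[OF p ps] bounded_linear_scaleR_right)
  have B: "bounded_linear B"
    unfolding B_def by (intro bounded_linear_compose[OF G'] bounded_linear_compose[OF p]
        bounded_linear_sub bounded_linear_compose[OF C Cs] bounded_linear_ident)
  interpret A: bounded_linear A by (rule A)
  interpret B: bounded_linear B by (rule B)
  have GAB: "G (A h + B m) \<bullet>\<^sub>r k =
      (ps h \<bullet>\<^sub>r ps (Vs k) - c * (h \<bullet>\<^sub>r Vs k)) + (m \<bullet>\<^sub>r ps k - Cs m \<bullet>\<^sub>r Cs (ps k))" for h m k
    by (simp add: G.add A_def B_def GG' rinner_simps adj p_adj C_adj)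
  have energy: "g (A h + B m) + c * (norm (defect (A h + B m)))\<^sup>2
      \<le> g h + (norm m)\<^sup>2 - (norm (Cs m))\<^sup>2" for h m
  proof -
    define u where "u = A h + B m"
    \<comment> \<open>The form on pairs is nonnegative at the residual
      \<open>(h - Vs u, m - ps u)\<close>. Its cross term and its value at
      \<open>(Vs u, ps u)\<close> both equal \<open>G u \<bullet>\<^sub>r u\<close>, by 3 and
      4.\<close>
    have 1: "0 \<le> g (h - Vs u)" by (rule g_nonneg)
    have 2: "(norm (Cs (m - ps u)))\<^sup>2 \<le> (norm (m - ps u))\<^sup>2"
      by (intro power_mono norm_Cs) simp
    have 3: "G u \<bullet>\<^sub>r u = (ps h \<bullet>\<^sub>r ps (Vs u) - c * (h \<bullet>\<^sub>r Vs u)) + (m \<bullet>\<^sub>r ps u - Cs m \<bullet>\<^sub>r Cs (ps u))"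
      unfolding GAB[of h m u, folded u_def] ..
    have 4: "G u \<bullet>\<^sub>r u = (norm (ps u))\<^sup>2 - c * (norm (Vs u))\<^sup>2"
      by (simp add: G_inner rinner_self)
    have "G u \<bullet>\<^sub>r u \<le> g h + (norm m)\<^sup>2 - (norm (Cs m))\<^sup>2"
      using 1 2 3 4
      by (simp add: g_def ps.diff Cs.diff norm_diff_sq inter right_diff_distrib distrib_left)
    then show ?thesis unfolding G_self u_def .
  qed
  \<comment> \<open>A pair \<open>(Vs h, ps h)\<close> is its own best approximation.\<close>
  have AB: "A (Vs h) + B (ps h) = h" for h
  proof -
    have "G (A (Vs h) + B (ps h)) \<bullet>\<^sub>r k = G h \<bullet>\<^sub>r k" for k
      unfolding GAB by (simp add: G_inner inter)
    then have "G (A (Vs h) + B (ps h)) = G h"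
      by (intro rinner_eqI) (simp only: rinner_commute)
    then have "G (A (Vs h) + B (ps h) - h) = 0" by (simp only: G.diff) simp
    then show ?thesis using G_inj by fastforce
  qed
  have defect_term_nonneg: "0 \<le> c * (norm (defect u))\<^sup>2" for u
    using c by simp
  have g_A: "g (A h) \<le> g h" for h
    using energy[of h 0] defect_term_nonneg[of "A h"] by (simp add: B.zero Cs.zero)
  have g_A_funpow: "g ((A ^^ N) h) \<le> g h" for N h
    by (induction N) (auto intro: order_trans[OF g_A])
  \<comment> \<open>The iterates, started at zero, of the fixed-point equation for
    \<open>\<Phi>\<close>.\<close>
  define F where "F N m = (\<Sum>n<N. (A ^^ n) (B ((Cs ^^ n) m)))" for N m
  have F_lin: "bounded_linear (F N)" for N
    unfolding F_def by (intro bounded_linear_sum bounded_linear_compose[OF bounded_linear_funpow[OF A]]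
        bounded_linear_compose[OF B] bounded_linear_funpow Cs)
  have F_add: "F (N + k) m = F N m + (A ^^ N) (F k ((Cs ^^ N) m))" for N k m
  proof -
    interpret AN: bounded_linear "A ^^ N" by (rule bounded_linear_funpow[OF A])
    have "(Cs ^^ (N + k)) m = (Cs ^^ k) ((Cs ^^ N) m)" for k
      using funpow_add[of k N Cs] by (simp add: add.commute)
    then show ?thesis
      by (induction k) (simp_all add: F_def AN.zero AN.add funpow_add[of N _ A])
  qed
  have F_Suc: "F (Suc N) m = A (F N (Cs m)) + B m" for N m
    using F_add[of 1 N m] by (simp add: F_def add.commute)
  have g_F: "g (F N m) \<le> (norm m)\<^sup>2 - (norm ((Cs ^^ N) m))\<^sup>2" for N m
  proof (induction N arbitrary: m)
    case 0
    then show ?case by (simp add: F_def g_def ps.zero)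
  next
    case (Suc N)
    have "g (F (Suc N) m) \<le> g (F N (Cs m)) + (norm m)\<^sup>2 - (norm (Cs m))\<^sup>2"
      using energy[of "F N (Cs m)" m] defect_term_nonneg[of "A (F N (Cs m)) + B m"]
      unfolding F_Suc by linarith
    also have "\<dots> \<le> (norm m)\<^sup>2 - (norm ((Cs ^^ Suc N) m))\<^sup>2"
      using Suc[of "Cs m"] by (simp add: funpow_swap1)
    finally show ?case .
  qed
  \<comment> \<open>An increment from index \<open>k\<close> on is \<open>A ^^ k\<close> applied to
    a partial sum at \<open>(Cs ^^ k) m\<close>. \<open>A\<close> does not increase
    \<open>g\<close>, and \<open>g_F\<close> bounds \<open>g\<close> of that partial sum by the drop
    of the square norm along the orbit of \<open>m\<close>.\<close>
  have "convergent (\<lambda>N. F N m)" for m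
  proof (intro Cauchy_convergent Cauchy_if_norm_sq_le[OF Cauchy_norm_sq_funpow[OF norm_Cs]])
    fix k N :: nat
    assume "k \<le> N"
    then obtain l where N: "N = k + l" using le_Suc_ex by blast
    have "c * (norm (F k m - F N m))\<^sup>2 = c * (norm ((A ^^ k) (F l ((Cs ^^ k) m))))\<^sup>2"
      by (simp add: N F_add)
    also have "\<dots> \<le> g (F l ((Cs ^^ k) m))"
      using g_lower g_A_funpow order_trans by blast
    also have "\<dots> \<le> (norm ((Cs ^^ k) m))\<^sup>2 - (norm ((Cs ^^ N) m))\<^sup>2"
      using g_F[of l "(Cs ^^ k) m"] by (simp add: N funpow_add[of l k] add.commute[of k])
    finally show "(norm (F k m - F N m))\<^sup>2
        \<le> (1 / c) * \<bar>(norm ((Cs ^^ k) m))\<^sup>2 - (norm ((Cs ^^ N) m))\<^sup>2\<bar>"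
      using c by (simp add: field_simps)
  qed
  then obtain \<Phi> where Phi: "\<And>m. (\<lambda>N. F N m) \<longlonglongrightarrow> \<Phi> m"
    unfolding convergent_def by metis
  have g_Phi: "g (\<Phi> m) \<le> (norm m)\<^sup>2" for m
  proof (rule LIMSEQ_le_const2)
    show "(\<lambda>N. g (F N m)) \<longlonglongrightarrow> g (\<Phi> m)"
      unfolding g_def by (intro tendsto_intros ps.tendsto Phi)
    show "\<exists>N0. \<forall>N\<ge>N0. g (F N m) \<le> (norm m)\<^sup>2"
      by (intro exI allI impI order_trans[OF g_F]) simp
  qed
  have Phi_lin: "bounded_linear \<Phi>"
  proof (rule bounded_linear_intro)
    fix x y :: 'm and a :: real
    have "(\<lambda>N. F N (x + y)) \<longlonglongrightarrow> \<Phi> x + \<Phi> y"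
      unfolding linear_add[OF bounded_linear.linear[OF F_lin]] by (intro tendsto_add Phi)
    then show "\<Phi> (x + y) = \<Phi> x + \<Phi> y" using Phi LIMSEQ_unique by blast
    have "(\<lambda>N. F N (a *\<^sub>R x)) \<longlonglongrightarrow> a *\<^sub>R \<Phi> x"
      unfolding linear_cmul[OF bounded_linear.linear[OF F_lin]] by (intro tendsto_intros Phi)
    then show "\<Phi> (a *\<^sub>R x) = a *\<^sub>R \<Phi> x" using Phi LIMSEQ_unique by blast
    have "c * (norm (\<Phi> x))\<^sup>2 \<le> (norm x)\<^sup>2"
      using g_lower g_Phi order_trans by blast
    then have "(norm (\<Phi> x))\<^sup>2 \<le> (norm x * sqrt (1 / c))\<^sup>2"
      using c by (simp add: power_mult_distrib field_simps)
    then show "norm (\<Phi> x) \<le> norm x * sqrt (1 / c)"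
      by (rule power2_le_imp_le) (use c in simp)
  qed
  \<comment> \<open>The error after \<open>N\<close> iterations is
    \<open>(A ^^ N) ((Vs ^^ N) h)\<close>. Purity enters here: \<open>(Vs ^^ N) h\<close> tends to
    0, and \<open>A\<close> does not increase \<open>g\<close>.\<close>
  have Phi_ps: "\<Phi> (ps h) = h" for h
  proof -
    have diff: "h - F N (ps h) = (A ^^ N) ((Vs ^^ N) h)" for N h
    proof (induction N arbitrary: h)
      case (Suc N)
      have "h - F (Suc N) (ps h) = A (Vs h - F N (ps (Vs h)))"
        using AB[of h] by (simp add: F_Suc inter A.diff algebra_simps)
      then show ?case by (simp add: Suc funpow_swap1)
    qed (simp add: F_def)
    have "(\<lambda>N. c * (norm (h - F N (ps h)))\<^sup>2) \<longlonglongrightarrow> 0"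
    proof (rule tendsto_sandwich)
      show "\<forall>\<^sub>F N in sequentially. 0 \<le> c * (norm (h - F N (ps h)))\<^sup>2" using c by simp
      have "c * (norm (h - F N (ps h)))\<^sup>2 \<le> (norm (ps ((Vs ^^ N) h)))\<^sup>2" for N
        unfolding diff using g_lower g_A_funpow g_upper by (meson order_trans)
      then show "\<forall>\<^sub>F N in sequentially. c * (norm (h - F N (ps h)))\<^sup>2 \<le> (norm (ps ((Vs ^^ N) h)))\<^sup>2"
        by simp
      have "(\<lambda>N. (norm (ps ((Vs ^^ N) h)))\<^sup>2) \<longlonglongrightarrow> (norm (ps 0))\<^sup>2"
        by (intro tendsto_intros ps.tendsto Vs_funpow_tendsto_0)
      then show "(\<lambda>N. (norm (ps ((Vs ^^ N) h)))\<^sup>2) \<longlonglongrightarrow> 0" by (simp add: ps.zero)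
    qed simp
    moreover have "(\<lambda>N. c * (norm (h - F N (ps h)))\<^sup>2) \<longlonglongrightarrow> c * (norm (h - \<Phi> (ps h)))\<^sup>2"
      by (intro tendsto_intros Phi)
    ultimately have "c * (norm (h - \<Phi> (ps h)))\<^sup>2 = 0" using LIMSEQ_unique by blast
    then show ?thesis using c by simp
  qed
  have Phi_rec: "\<Phi> m = A (\<Phi> (Cs m)) + B m" for m
  proof -
    have "(\<lambda>N. F (Suc N) m) \<longlonglongrightarrow> A (\<Phi> (Cs m)) + B m"
      unfolding F_Suc by (intro tendsto_intros A.tendsto Phi)
    then show ?thesis using Phi LIMSEQ_Suc LIMSEQ_unique by blast
  qed
  \<comment> \<open>Sums \<open>energy\<close> along the orbit of \<open>m\<close> under
    \<open>Cs\<close>; the terms in \<open>g\<close> and in the square norms telescope.\<close>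
  have telescope: "c * (\<Sum>n<N. (norm (defect (\<Phi> ((Cs ^^ n) m))))\<^sup>2)
      \<le> g (\<Phi> ((Cs ^^ N) m)) - g (\<Phi> m) + (norm m)\<^sup>2 - (norm ((Cs ^^ N) m))\<^sup>2" for N m
  proof (induction N)
    case (Suc N)
    then show ?case
      using energy[of "\<Phi> (Cs ((Cs ^^ N) m))" "(Cs ^^ N) m", folded Phi_rec]
      by (simp add: distrib_left)
  qed simp
  have "c * (\<Sum>n<N. (norm (defect (\<Phi> ((Cs ^^ n) m))))\<^sup>2) \<le> (norm m)\<^sup>2" for N m
    using telescope[where N=N and m=m] g_Phi[of "(Cs ^^ N) m"] g_nonneg[of "\<Phi> m"] by linarith
  with Phi_lin Phi_ps show thesis by (rule that)
qed

text \<open>By duality: \<open>r\<close> is the adjoint of \<open>\<Phi>\<close>, and on kernel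
  vectors the sum of \<open>(C ^^ n) (r (y n))\<close> is adjoint to
  \<open>m \<mapsto> (defect (\<Phi> ((Cs ^^ n) m)))\<close>, which is square bounded. The right
  inverse \<open>j\<close> bounds \<open>ps\<close> from below.\<close>

lemma square_summable_lifting:
  fixes C :: "'m::complex_hilbert \<Rightarrow> 'm" and p :: "'m \<Rightarrow> 'h" and j :: "'h \<Rightarrow> 'm"
  assumes C: "bounded_linear C" and norm_C: "\<And>m. norm (C m) \<le> norm m"
    and p: "bounded_linear p" and j: "bounded_linear j" and p_j: "\<And>h. p (j h) = h"
    and inter: "\<And>m. p (C m) = V (p m)"
  obtains r s where "bounded_linear r" and "\<And>y. p (r y) = y" and "s \<ge> 0"
    and "\<And>N y. (\<And>n. n < N \<Longrightarrow> Vs (y n) = 0) \<Longrightarrow>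
      norm (\<Sum>n<N. (C ^^ n) (r (y n))) \<le> s * sqrt (\<Sum>n<N. (norm (y n))\<^sup>2)"
proof -
  obtain Cs where Cs: "bounded_linear Cs" and C_adj: "\<And>x y. C x \<bullet>\<^sub>r y = x \<bullet>\<^sub>r Cs y"
    using hilbert_adjoint[OF C] by blast
  obtain ps where ps: "bounded_linear ps" and p_adj: "\<And>x y. p x \<bullet>\<^sub>r y = x \<bullet>\<^sub>r ps y"
    using hilbert_adjoint[OF p] by blast
  have inter': "Cs (ps h) = ps (Vs h)" for h
    by (rule rinner_eqI) (simp add: inter adj flip: C_adj p_adj)
  obtain K where K: "\<And>h. norm (j h) \<le> norm h * K" and "K > 0"
    using bounded_linear.pos_bounded[OF j] by blast
  \<comment> \<open>Pairing \<open>j h\<close> with \<open>ps h\<close> gives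
    \<open>norm h \<le> K * norm (ps h)\<close>, which is \<open>lower\<close> for this
    \<open>c\<close>.\<close>
  define c where "c = 1 / (2 * K\<^sup>2)"
  have c: "c > 0" using \<open>K > 0\<close> by (simp add: c_def)
  have lower: "2 * c * (norm h)\<^sup>2 \<le> (norm (ps h))\<^sup>2" for h
  proof (cases "norm h = 0")
    case False
    have "norm h * norm h = j h \<bullet>\<^sub>r ps h"
      by (simp add: p_j rinner_self flip: p_adj power2_eq_square)
    also have "\<dots> \<le> norm (j h) * norm (ps h)" using rinner_le_norm abs_le_iff by blast
    also have "\<dots> \<le> norm h * K * norm (ps h)" by (intro mult_right_mono K) simp
    finally have "norm h * norm h \<le> norm h * (K * norm (ps h))" by (simp add: mult_ac)
    then have "norm h \<le> K * norm (ps h)" using False by (simp add: mult_le_cancel_left)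
    then have "(norm h)\<^sup>2 \<le> (K * norm (ps h))\<^sup>2" by (intro power_mono) auto
    then show ?thesis using \<open>K > 0\<close> by (simp add: c_def power_mult_distrib field_simps)
  qed simp
  obtain \<Phi> where Phi: "bounded_linear \<Phi>" and Phi_ps: "\<And>h. \<Phi> (ps h) = h"
    and Phi_sum: "\<And>N m. c * (\<Sum>n<N. (norm (defect (\<Phi> ((Cs ^^ n) m))))\<^sup>2) \<le> (norm m)\<^sup>2"
    using square_summable_left_inverse[OF C Cs C_adj adjoint_contraction[OF norm_C C_adj] p ps p_adj
        inter' c lower] by blast
  obtain r where r: "bounded_linear r" and r_adj: "\<And>x y. \<Phi> x \<bullet>\<^sub>r y = x \<bullet>\<^sub>r r y"
    using hilbert_adjoint[OF Phi] by blast
  have p_r: "p (r y) = y" for y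
    by (rule rinner_eqI) (metis Phi_ps p_adj r_adj rinner_commute)
  define s where "s = sqrt (1 / c)"
  have s: "s \<ge> 0" using c by (simp add: s_def)
  have bound: "norm (\<Sum>n<N. (C ^^ n) (r (y n))) \<le> s * sqrt (\<Sum>n<N. (norm (y n))\<^sup>2)"
    if ker: "\<And>n. n < N \<Longrightarrow> Vs (y n) = 0" for N y
  proof -
    define m where "m = (\<Sum>n<N. (C ^^ n) (r (y n)))"
    define d where "d n = defect (\<Phi> ((Cs ^^ n) m))" for n
    \<comment> \<open>Since \<open>y n\<close> lies in the kernel of \<open>Vs\<close>, the
      projection \<open>defect\<close> can be inserted in the pairing.\<close>
    have inner_y_d: "(C ^^ n) (r (y n)) \<bullet>\<^sub>r m = y n \<bullet>\<^sub>r d n" if "n < N" for n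
    proof -
      have "(C ^^ n) (r (y n)) \<bullet>\<^sub>r m = (Cs ^^ n) m \<bullet>\<^sub>r r (y n)"
        by (metis adjoint_funpow[OF C_adj] rinner_commute)
      also have "\<dots> = y n \<bullet>\<^sub>r \<Phi> ((Cs ^^ n) m)" by (metis r_adj rinner_commute)
      also have "\<dots> = y n \<bullet>\<^sub>r d n" using kernel_inner_defect[OF ker[OF that]] by (simp add: d_def)
      finally show ?thesis .
    qed
    have "(norm m)\<^sup>2 = (\<Sum>n<N. (C ^^ n) (r (y n)) \<bullet>\<^sub>r m)"
      unfolding rinner.sum_left[symmetric] m_def[symmetric] by (simp add: rinner_self)
    also have "\<dots> \<le> (\<Sum>n<N. \<bar>norm (y n)\<bar> * \<bar>norm (d n)\<bar>)"
      using rinner_le_norm[of "y _" "d _"] by (intro sum_mono) (auto simp: inner_y_d abs_le_iff)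
    also have "\<dots> \<le> L2_set (\<lambda>n. norm (y n)) {..<N} * L2_set (\<lambda>n. norm (d n)) {..<N}"
      by (rule L2_set_mult_ineq)
    also have "\<dots> \<le> sqrt (\<Sum>n<N. (norm (y n))\<^sup>2) * (s * norm m)"
    proof (unfold L2_set_def, intro mult_left_mono)
      have "(\<Sum>n<N. (norm (d n))\<^sup>2) \<le> (1 / c) * (norm m)\<^sup>2"
        using Phi_sum[where N=N and m=m] c unfolding d_def by (simp add: field_simps)
      then have "sqrt (\<Sum>n<N. (norm (d n))\<^sup>2) \<le> sqrt ((1 / c) * (norm m)\<^sup>2)" by simp
      then show "sqrt (\<Sum>n<N. (norm (d n))\<^sup>2) \<le> s * norm m"
        by (simp only: real_sqrt_mult s_def) simp
    qed (simp add: sum_nonneg)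
    finally have *: "norm m * norm m \<le> norm m * (s * sqrt (\<Sum>n<N. (norm (y n))\<^sup>2))"
      by (simp add: power2_eq_square mult_ac)
    show ?thesis
    proof (cases "norm m = 0")
      case True
      then show ?thesis using s by (simp add: m_def[symmetric] sum_nonneg)
    next
      case False
      then show ?thesis using * by (simp add: m_def[symmetric] mult_le_cancel_left)
    qed
  qed
  show thesis using that[OF r p_r s] bound by blast
qed

end

text \<open>\<open>L\<close> sends the Wold series of \<open>h\<close>, with terms
  \<open>(V ^^ n) (w n h)\<close>, to the series of \<open>D n (w n h)\<close>, which converges by
  the square bound. \<open>D\<close> stands for the corners of the powers of a triangular operator,
  and its recursion becomes the equation for \<open>L\<close>.\<close>

lemma (in shift) intertwiner_of_square_bounded:
  fixes D :: "nat \<Rightarrow> 'h \<Rightarrow> 'k::complex_hilbert"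
  assumes T: "bounded_linear T" and A: "bounded_linear A"
    and D_0: "\<And>y. D 0 y = 0" and D_Suc: "\<And>n y. D (Suc n) y = T (D n y) + A ((V ^^ n) y)"
    and s: "s \<ge> 0"
    and bound: "\<And>N y. (\<And>n. n < N \<Longrightarrow> Vs (y n) = 0) \<Longrightarrow>
      norm (\<Sum>n<N. D n (y n)) \<le> s * sqrt (\<Sum>n<N. (norm (y n))\<^sup>2)"
  obtains L where "bounded_linear L" and "\<And>h. L (V h) = T (L h) + A h"
proof -
  interpret T: bounded_linear T by (rule T)
  interpret A: bounded_linear A by (rule A)
  interpret Vs: bounded_linear Vs by (rule Vs)
  interpret defect: bounded_linear defect by (rule bounded_linear_defect)
  have D: "bounded_linear (D n)" for n
  proof (induction n)
    case 0
    then show ?case by (simp add: D_0[abs_def])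
  next
    case (Suc n)
    then show ?case
      unfolding D_Suc[abs_def] by (intro bounded_linear_add bounded_linear_compose[OF T]
          bounded_linear_compose[OF A] bounded_linear_funpow V)
  qed
  \<comment> \<open>The Wold coefficients of \<open>h\<close>, which lie in the kernel of
    \<open>Vs\<close>.\<close>
  define w where "w n h = defect ((Vs ^^ n) h)" for n h
  have w_ker: "Vs (w n h) = 0" for n h by (simp add: w_def)
  have w_sum: "(\<Sum>n=k..<N. (norm (w n h))\<^sup>2) = (norm ((Vs ^^ k) h))\<^sup>2 - (norm ((Vs ^^ N) h))\<^sup>2"
    if "k \<le> N" for k N h
    using that by (induction N rule: dec_induct) (simp_all add: w_def norm_defect_sq)
  have w_lin: "bounded_linear (w n)" for n
    unfolding w_def by (intro bounded_linear_compose[OF bounded_linear_defect] bounded_linear_funpow Vs)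
  define F where "F N h = (\<Sum>n<N. D n (w n h))" for N h
  have F_lin: "bounded_linear (F N)" for N
    unfolding F_def by (intro bounded_linear_sum bounded_linear_compose[OF D] w_lin)
  have F_diff: "norm (F N h - F k h) \<le> s * sqrt ((norm ((Vs ^^ k) h))\<^sup>2 - (norm ((Vs ^^ N) h))\<^sup>2)"
    if "k \<le> N" for k N h
  proof -
    \<comment> \<open>Padding with zeros, because \<open>bound\<close> concerns sums that start at
      index 0.\<close>
    define y where "y n = (if n < k then 0 else w n h)" for n
    have split: "{..<N} = {..<k} \<union> {k..<N}" "{..<k} \<inter> {k..<N} = {}" using that by auto
    have "(\<Sum>n<N. D n (y n)) = (\<Sum>n=k..<N. D n (w n h))"
      unfolding split(1) by (subst sum.union_disjoint)
        (auto simp: y_def linear_0[OF bounded_linear.linear[OF D]])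
    also have "\<dots> = F N h - F k h"
      unfolding F_def split(1) by (subst sum.union_disjoint) auto
    finally have 1: "F N h - F k h = (\<Sum>n<N. D n (y n))" ..
    have 2: "(\<Sum>n<N. (norm (y n))\<^sup>2) = (\<Sum>n=k..<N. (norm (w n h))\<^sup>2)"
      unfolding split(1) by (subst sum.union_disjoint) (auto simp: y_def)
    show ?thesis
      unfolding 1 w_sum[OF that, symmetric] 2[symmetric]
      by (rule bound) (simp add: y_def w_ker Vs.zero)
  qed
  have "convergent (\<lambda>N. F N h)" for h
  proof (intro Cauchy_convergent Cauchy_if_norm_sq_le[OF Cauchy_norm_sq_funpow[OF norm_Vs]])
    fix k N :: nat
    assume "k \<le> N"
    let ?a = "(norm ((Vs ^^ k) h))\<^sup>2 - (norm ((Vs ^^ N) h))\<^sup>2"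
    have a: "?a \<ge> 0" unfolding w_sum[OF \<open>k \<le> N\<close>, symmetric] by (simp add: sum_nonneg)
    have "(norm (F k h - F N h))\<^sup>2 \<le> (s * sqrt ?a)\<^sup>2"
      using F_diff[OF \<open>k \<le> N\<close>] by (intro power_mono) (simp_all add: norm_minus_commute)
    then show "(norm (F k h - F N h))\<^sup>2 \<le> s\<^sup>2 * \<bar>?a\<bar>"
      using a by (simp add: power_mult_distrib)
  qed
  then obtain L where L: "\<And>h. (\<lambda>N. F N h) \<longlonglongrightarrow> L h"
    unfolding convergent_def by metis
  have "bounded_linear L"
  proof (rule bounded_linear_intro)
    fix x y :: 'h and a :: real
    have "(\<lambda>N. F N (x + y)) \<longlonglongrightarrow> L x + L y"
      unfolding linear_add[OF bounded_linear.linear[OF F_lin]] by (intro tendsto_add L)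
    then show "L (x + y) = L x + L y" using L LIMSEQ_unique by blast
    have "(\<lambda>N. F N (a *\<^sub>R x)) \<longlonglongrightarrow> a *\<^sub>R L x"
      unfolding linear_cmul[OF bounded_linear.linear[OF F_lin]] by (intro tendsto_intros L)
    then show "L (a *\<^sub>R x) = a *\<^sub>R L x" using L LIMSEQ_unique by blast
    have "norm (F N x) \<le> norm x * s" for N
    proof -
      have "norm (F N x) \<le> s * sqrt ((norm x)\<^sup>2 - (norm ((Vs ^^ N) x))\<^sup>2)"
        using F_diff[of 0 N x] by (simp add: F_def)
      also have "\<dots> \<le> s * sqrt ((norm x)\<^sup>2)"
        using s by (intro mult_left_mono real_sqrt_le_mono) simp_all
      finally show ?thesis by (simp add: mult.commute)
    qed
    then show "norm (L x) \<le> norm x * s"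
      by (intro LIMSEQ_le_const2[OF tendsto_norm[OF L]]) blast
  qed
  moreover have "L (V h) = T (L h) + A h" for h
  proof -
    have w_V: "w (Suc n) (V h) = w n h" for n
      unfolding w_def funpow_Suc_right by simp
    \<comment> \<open>Applying \<open>V\<close> shifts the coefficients by one. The term at index 0
      drops out by \<open>D_0\<close>, and \<open>D_Suc\<close> splits the others into a part under
      \<open>T\<close> and a partial Wold sum under \<open>A\<close>.\<close>
    have rec: "F (Suc N) (V h) = T (F N h) + A (h - (V ^^ N) ((Vs ^^ N) h))" for N
      unfolding sum_shifted_defects[symmetric] F_def w_def[symmetric]
      by (simp only: sum.lessThan_Suc_shift w_V D_Suc D_0 sum.distrib T.sum A.sum add_0)
    have "(\<lambda>N. F (Suc N) (V h)) \<longlonglongrightarrow> T (L h) + A (h - 0)"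
      unfolding rec by (intro tendsto_intros T.tendsto A.tendsto L range_projection_tendsto_0)
    then have "(\<lambda>N. F (Suc N) (V h)) \<longlonglongrightarrow> T (L h) + A h" by simp
    then show ?thesis using LIMSEQ_Suc[OF L] LIMSEQ_unique by blast
  qed
  ultimately show thesis by (rule that)
qed

section \<open>Complex linearity\<close>

lemma scaleC_Re_Im: "scaleC c x = Re c *\<^sub>R x + Im c *\<^sub>R scaleC \<i> x"
proof -
  have "c = of_real (Re c) + of_real (Im c) * \<i>"
    by (simp add: complex_eq_iff)
  then have "scaleC c x = scaleC (of_real (Re c) + of_real (Im c) * \<i>) x"
    by (rule arg_cong)
  then show ?thesis by (simp add: scaleC_add_left scaleC_of_real flip: scaleC_scaleC)
qed

lemma scaleC_i_i [simp]: "scaleC \<i> (scaleC \<i> x) = - x"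
  by (simp add: scaleC_scaleC scaleC_of_real[of "-1", simplified])

lemma bounded_linear_scaleC: "bounded_linear (scaleC c :: 'a::complex_normed_vector \<Rightarrow> 'a)"
proof (rule bounded_linear_intro[of _ "cmod c"])
  show "scaleC c (r *\<^sub>R x) = r *\<^sub>R scaleC c x" for r and x :: 'a
    unfolding scaleC_of_real[symmetric] scaleC_scaleC by (simp add: mult.commute)
qed (simp_all add: scaleC_add_right norm_scaleC mult.commute)

text \<open>Real multiples and \<open>\<i>\<close> generate all scalars, so real linearity and
  commutation with \<open>\<i>\<close> are enough.\<close>

lemma bounded_clinear_iff:
  "bounded_clinear f \<longleftrightarrow> bounded_linear f \<and> (\<forall>x. f (scaleC \<i> x) = scaleC \<i> (f x))"
proof
  assume f: "bounded_clinear f"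
  then obtain K where "\<And>x. norm (f x) \<le> norm x * K" unfolding bounded_clinear_def by blast
  moreover have "f (x + y) = f x + f y" "f (r *\<^sub>R x) = r *\<^sub>R f x" for x y r
    using f unfolding bounded_clinear_def scaleC_of_real[symmetric] by blast+
  ultimately have "bounded_linear f" by (intro bounded_linear_intro)
  then show "bounded_linear f \<and> (\<forall>x. f (scaleC \<i> x) = scaleC \<i> (f x))"
    using f unfolding bounded_clinear_def by blast
next
  assume f: "bounded_linear f \<and> (\<forall>x. f (scaleC \<i> x) = scaleC \<i> (f x))"
  then interpret f: bounded_linear f by blast
  have "f (scaleC c x) = scaleC c (f x)" for c x
    using f by (simp add: scaleC_Re_Im[of c] f.add f.scaleR)
  then show "bounded_clinear f"
    unfolding bounded_clinear_def using f.add f.bounded by blast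
qed

lemma bounded_clinear_0: "bounded_clinear f \<Longrightarrow> f 0 = 0"
  by (simp add: bounded_clinear_iff bounded_linear.linear linear_0)

lemma bounded_clinear_sum_iff: "bounded_clinear_sum f \<longleftrightarrow> bounded_clinear f"
  unfolding bounded_clinear_sum_def bounded_clinear_def ..

section \<open>Closure properties of bounded complex-linear maps\<close>

lemma bounded_clinear_compose:
  "bounded_clinear f \<Longrightarrow> bounded_clinear g \<Longrightarrow> bounded_clinear (\<lambda>x. f (g x))"
  unfolding bounded_clinear_iff by (simp add: bounded_linear_compose)

lemma bounded_clinear_add:
  "bounded_clinear f \<Longrightarrow> bounded_clinear g \<Longrightarrow> bounded_clinear (\<lambda>x. f x + g x)"
  unfolding bounded_clinear_iff by (simp add: bounded_linear_add scaleC_add_right)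

lemma bounded_clinear_diff:
  assumes "bounded_clinear f" and "bounded_clinear g"
  shows "bounded_clinear (\<lambda>x. f x - g x)"
  using assms unfolding bounded_clinear_iff
  by (simp add: bounded_linear_sub linear_diff[OF bounded_linear.linear[OF bounded_linear_scaleC]])

lemma bounded_clinear_Pair:
  "bounded_clinear f \<Longrightarrow> bounded_clinear g \<Longrightarrow> bounded_clinear (\<lambda>x. (f x, g x))"
  unfolding bounded_clinear_iff by (simp add: bounded_linear_Pair scaleC_prod_def)

lemma bounded_clinear_ident: "bounded_clinear (\<lambda>x. x)"
  by (simp add: bounded_clinear_iff bounded_linear_ident)

lemma bounded_clinear_fst: "bounded_clinear fst"
  by (simp add: bounded_clinear_iff bounded_linear_fst scaleC_prod_def)

lemma bounded_clinear_snd: "bounded_clinear snd"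
  by (simp add: bounded_clinear_iff bounded_linear_snd scaleC_prod_def)

lemma bounded_clinear_zero: "bounded_clinear (\<lambda>x. 0)"
  by (simp add: bounded_clinear_iff linear_0[OF bounded_linear.linear[OF bounded_linear_scaleC]])

lemma bounded_clinear_funpow:
  fixes f :: "'a::complex_normed_vector \<Rightarrow> 'a"
  assumes "bounded_clinear f"
  shows "bounded_clinear (f ^^ n)"
proof (induction n)
  case 0
  then show ?case using bounded_clinear_ident by (simp add: id_def)
next
  case (Suc n)
  then show ?case using bounded_clinear_compose[OF assms] by (simp add: o_def)
qed

lemma bounded_clinear_opR:
  assumes "bounded_clinear T" and "bounded_clinear V" and "bounded_clinear Y"
  shows "bounded_clinear (opR T V Y)"
proof -
  have "opR T V Y = (\<lambda>x. (T (fst x) + Y (snd x), V (snd x)))"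
    by (auto simp: opR_def)
  then show ?thesis
    by (simp add: bounded_clinear_Pair bounded_clinear_add bounded_clinear_compose[OF _ bounded_clinear_fst]
        bounded_clinear_compose[OF _ bounded_clinear_snd] assms)
qed

text \<open>The average of \<open>f\<close> and its conjugate under multiplication by
  \<open>\<i>\<close>, which removes the antilinear part of a real-linear map.\<close>

definition clinear_part :: "('a::complex_normed_vector \<Rightarrow> 'b::complex_normed_vector) \<Rightarrow> 'a \<Rightarrow> 'b" where
  "clinear_part f x = (1/2) *\<^sub>R (f x - scaleC \<i> (f (scaleC \<i> x)))"

lemma bounded_clinear_clinear_part:
  assumes f: "bounded_linear f"
  shows "bounded_clinear (clinear_part f)"
proof -
  interpret f: bounded_linear f by (rule f)
  interpret i: bounded_linear "scaleC \<i> :: 'b \<Rightarrow> 'b" by (rule bounded_linear_scaleC)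
  have "bounded_linear (clinear_part f)"
    unfolding clinear_part_def
    by (intro bounded_linear_compose[OF bounded_linear_scaleR_right] bounded_linear_sub f
        bounded_linear_compose[OF bounded_linear_scaleC] bounded_linear_compose[OF f]
        bounded_linear_ident)
  moreover have "clinear_part f (scaleC \<i> x) = scaleC \<i> (clinear_part f x)" for x
    by (simp add: clinear_part_def i.scaleR i.diff i.neg f.neg algebra_simps)
  ultimately show ?thesis by (simp add: bounded_clinear_iff)
qed

lemma clinear_part_comp_left:
  assumes "bounded_clinear g"
  shows "clinear_part (\<lambda>x. g (f x)) x = g (clinear_part f x)"
proof -
  interpret g: bounded_linear g using assms by (simp add: bounded_clinear_iff)
  show ?thesis using assms by (simp add: clinear_part_def bounded_clinear_iff g.scaleR g.diff)
qed

lemma clinear_part_comp_right: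
  "bounded_clinear g \<Longrightarrow> clinear_part (\<lambda>x. f (g x)) x = clinear_part f (g x)"
  by (simp add: clinear_part_def bounded_clinear_iff)

lemma clinear_part_add: "clinear_part (\<lambda>x. f x + g x) x = clinear_part f x + clinear_part g x"
  by (simp add: clinear_part_def scaleC_add_right algebra_simps)

lemma clinear_part_of_clinear: "bounded_clinear f \<Longrightarrow> clinear_part f x = f x"
  by (simp add: clinear_part_def bounded_clinear_iff flip: scaleR_2)

section \<open>Upper triangular operators\<close>

text \<open>The upper right entry of the \<open>n\<close>-th power of \<open>opR T V Y\<close>; the
  recursion has the form required of \<open>D\<close> in
  \<open>intertwiner_of_square_bounded\<close>.\<close>

primrec corner :: "('k::ab_group_add \<Rightarrow> 'k) \<Rightarrow> ('h \<Rightarrow> 'h) \<Rightarrow> ('h \<Rightarrow> 'k) \<Rightarrow> nat \<Rightarrow> 'h \<Rightarrow> 'k" where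
  "corner T V Y 0 h = 0"
| "corner T V Y (Suc n) h = T (corner T V Y n h) + Y ((V ^^ n) h)"

lemma opR_funpow:
  assumes "bounded_linear T"
  shows "(opR T V Y ^^ n) (k, h) = ((T ^^ n) k + corner T V Y n h, (V ^^ n) h)"
proof -
  interpret T: bounded_linear T by (rule assms)
  show ?thesis by (induction n) (simp_all add: opR_def T.add add.assoc)
qed

lemma corner_zero:
  assumes "bounded_linear T"
  shows "corner T V (\<lambda>_. 0) n h = 0"
proof -
  interpret T: bounded_linear T by (rule assms)
  show ?thesis by (induction n) (simp_all add: T.zero)
qed

lemma opR_funpow_diff:
  fixes V :: "'h::ab_group_add \<Rightarrow> 'h"
  assumes "bounded_linear T"
  shows "(opR T V Y ^^ n) (0, h) - (opR T V (\<lambda>_. 0) ^^ n) (0, h) = (corner T V Y n h, 0)"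
  by (simp add: opR_funpow[OF assms] corner_zero[OF assms])

text \<open>The unipotent triangular operator with corner \<open>- L\<close> conjugates
  \<open>opR T V X\<close> to the direct sum of \<open>T\<close> and \<open>V\<close>: the equation
  \<open>X\<close> cancels the corner.\<close>

lemma opR_similar_to_contraction:
  fixes T :: "'k::complex_hilbert \<Rightarrow> 'k" and V :: "'h::complex_hilbert \<Rightarrow> 'h"
  assumes T: "contraction T" and V: "contraction V" and L: "bounded_clinear L"
    and X: "\<And>h. L (V h) = T (L h) + X h"
  shows "similar_to_contraction (opR T V X)"
proof -
  have T': "bounded_clinear T" and norm_T: "\<And>x. norm (T x) \<le> norm x"
    and V': "bounded_clinear V" and norm_V: "\<And>x. norm (V x) \<le> norm x"
    using T V by (simp_all add: contraction_def)
  interpret T: bounded_linear T using T' by (simp add: bounded_clinear_iff)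
  note compL = bounded_clinear_compose[OF L bounded_clinear_snd]
  define S :: "'k \<times> 'h \<Rightarrow> 'k \<times> 'h" where "S = (\<lambda>x. (fst x - L (snd x), snd x))"
  define S' :: "'k \<times> 'h \<Rightarrow> 'k \<times> 'h" where "S' = (\<lambda>x. (fst x + L (snd x), snd x))"
  have S: "bounded_clinear S" and S': "bounded_clinear S'"
    unfolding S_def S'_def by (intro bounded_clinear_Pair bounded_clinear_diff bounded_clinear_add
        compL bounded_clinear_fst bounded_clinear_snd)+
  have conj: "S \<circ> opR T V X \<circ> S' = opR T V (\<lambda>_. 0)"
    by (rule ext) (auto simp: S_def S'_def opR_def T.add X)
  have R0: "bounded_clinear (opR T V (\<lambda>_. 0))"
    by (intro bounded_clinear_opR T' V' bounded_clinear_zero)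
  have "norm (opR T V (\<lambda>_. 0) x) \<le> norm x" for x
  proof (cases x)
    case (Pair k h)
    then show ?thesis
      using norm_T[of k] norm_V[of h] by (simp add: opR_def norm_Pair add_mono power_mono)
  qed
  moreover have "S \<circ> S' = id" "S' \<circ> S = id"
    by (auto simp: S_def S'_def)
  ultimately show ?thesis
    unfolding similar_to_contraction_def bounded_clinear_sum_iff
    using S S' R0 conj by (intro exI[of _ S] exI[of _ S']) simp
qed

text \<open>A real-linear lifting is enough: its complex-linear part is again a lifting.\<close>

lemma clinear_square_summable_lifting:
  fixes C :: "'m::complex_hilbert \<Rightarrow> 'm" and p :: "'m \<Rightarrow> 'h::complex_hilbert" and j :: "'h \<Rightarrow> 'm"
  assumes sh: "shift V Vs" and Vs_i: "\<And>x. Vs (scaleC \<i> x) = scaleC \<i> (Vs x)"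
    and C: "contraction C" and p: "bounded_clinear p" and j: "bounded_linear j"
    and p_j: "\<And>h. p (j h) = h" and inter: "\<And>m. p (C m) = V (p m)"
  obtains r s where "bounded_clinear r" and "\<And>y. p (r y) = y" and "s \<ge> 0"
    and "\<And>N y. (\<And>n. n < N \<Longrightarrow> Vs (y n) = 0) \<Longrightarrow>
      norm (\<Sum>n<N. (C ^^ n) (r (y n))) \<le> s * sqrt (\<Sum>n<N. (norm (y n))\<^sup>2)"
proof -
  interpret shift V Vs by (rule sh)
  have C': "bounded_clinear C" and norm_C: "\<And>m. norm (C m) \<le> norm m"
    using C by (simp_all add: contraction_def)
  interpret i: bounded_linear "scaleC \<i> :: 'm \<Rightarrow> 'm" by (rule bounded_linear_scaleC)
  obtain r s where r: "bounded_linear r" and p_r: "\<And>y. p (r y) = y" and s: "s \<ge> 0"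
    and bound: "\<And>N y. (\<And>n. n < N \<Longrightarrow> Vs (y n) = 0) \<Longrightarrow>
      norm (\<Sum>n<N. (C ^^ n) (r (y n))) \<le> s * sqrt (\<Sum>n<N. (norm (y n))\<^sup>2)"
    using square_summable_lifting[OF _ norm_C _ j p_j inter] C' p
    unfolding bounded_clinear_iff by blast
  have "p (clinear_part r y) = y" for y
    unfolding clinear_part_comp_left[OF p, symmetric] p_r
    by (rule clinear_part_of_clinear[OF bounded_clinear_ident])
  moreover have "norm (\<Sum>n<N. (C ^^ n) (clinear_part r (y n))) \<le> s * sqrt (\<Sum>n<N. (norm (y n))\<^sup>2)"
    if ker: "\<And>n. n < N \<Longrightarrow> Vs (y n) = 0" for N y
  proof -
    let ?S = "s * sqrt (\<Sum>n<N. (norm (y n))\<^sup>2)"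
    \<comment> \<open>The vectors \<open>scaleC \<i> (y n)\<close> lie in the kernel of
      \<open>Vs\<close> and have the norms of \<open>y n\<close>, so both halves of the average obey
      the same bound.\<close>
    have "(\<Sum>n<N. (C ^^ n) (clinear_part r (y n))) =
      (1/2) *\<^sub>R ((\<Sum>n<N. (C ^^ n) (r (y n))) - scaleC \<i> (\<Sum>n<N. (C ^^ n) (r (scaleC \<i> (y n)))))"
      unfolding clinear_part_comp_left[OF bounded_clinear_funpow[OF C'], symmetric]
      by (simp add: clinear_part_def i.sum sum_subtractf flip: scaleR_sum_right)
    also have "norm \<dots> \<le> (1/2) * (norm (\<Sum>n<N. (C ^^ n) (r (y n))) +
        norm (\<Sum>n<N. (C ^^ n) (r (scaleC \<i> (y n)))))"
      using norm_triangle_ineq4[of "\<Sum>n<N. (C ^^ n) (r (y n))"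
          "scaleC \<i> (\<Sum>n<N. (C ^^ n) (r (scaleC \<i> (y n))))"]
      by (simp add: norm_scaleC)
    also have "\<dots> \<le> (1/2) * (?S + ?S)"
    proof (intro mult_left_mono add_mono)
      show "norm (\<Sum>n<N. (C ^^ n) (r (y n))) \<le> ?S" by (rule bound[OF ker])
      have "Vs (scaleC \<i> (y n)) = 0" if "n < N" for n
        using ker[OF that] linear_0[OF bounded_linear.linear[OF bounded_linear_scaleC]] by (simp add: Vs_i)
      then show "norm (\<Sum>n<N. (C ^^ n) (r (scaleC \<i> (y n)))) \<le> ?S"
        using bound[of N "\<lambda>n. scaleC \<i> (y n)"] by (simp add: norm_scaleC)
    qed simp
    finally show ?thesis by simp
  qed
  ultimately show thesis
    using that[OF bounded_clinear_clinear_part[OF r] _ s] by blast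
qed

text \<open>The perturbation \<open>T (l (defect h))\<close> vanishes on the range of
  \<open>V\<close>. On kernel vectors it makes the corner for \<open>A\<close> at each
  \<open>n \<ge> 1\<close> the first coordinate of the \<open>n\<close>-th power of
  \<open>opR T V X\<close> at \<open>(l y, y)\<close>, and the lifting bounds sums of these.\<close>

lemma quadratically_near_perturbation:
  fixes T :: "'k::complex_hilbert \<Rightarrow> 'k" and V :: "'h::complex_hilbert \<Rightarrow> 'h" and X :: "'h \<Rightarrow> 'k"
  assumes sh: "shift V Vs" and Vs_i: "\<And>x. Vs (scaleC \<i> x) = scaleC \<i> (Vs x)"
    and V': "bounded_clinear V" and T: "bounded_clinear T" and X: "bounded_clinear X"
    and sim: "similar_to_contraction (opR T V X)"
  obtains A s where "bounded_clinear A" and "\<And>h. A (V h) = X (V h)"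
    and "\<And>N y. (\<And>n. n < N \<Longrightarrow> Vs (y n) = 0) \<Longrightarrow>
      norm (\<Sum>n<N. corner T V A n (y n)) \<le> s * sqrt (\<Sum>n<N. (norm (y n))\<^sup>2)"
proof -
  interpret shift V Vs by (rule sh)
  have T_lin: "bounded_linear T" using T by (simp add: bounded_clinear_iff)
  interpret T: bounded_linear T by (rule T_lin)
  obtain S S' :: "'k \<times> 'h \<Rightarrow> 'k \<times> 'h" where S: "bounded_clinear S" and S': "bounded_clinear S'"
    and inv: "S \<circ> S' = id" "S' \<circ> S = id"
    and C0: "bounded_clinear (S \<circ> opR T V X \<circ> S')"
    and C1: "\<And>x. norm ((S \<circ> opR T V X \<circ> S') x) \<le> norm x"
    using sim unfolding similar_to_contraction_def bounded_clinear_sum_iff by blast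
  have inv': "S (S' x) = x" "S' (S x) = x" for x
    using fun_cong[OF inv(1), of x] fun_cong[OF inv(2), of x] by simp_all
  define C where "C = S \<circ> opR T V X \<circ> S'"
  \<comment> \<open>Second coordinate in the original frame; it intertwines \<open>C\<close> with
    \<open>V\<close> since \<open>opR T V X\<close> acts there as \<open>V\<close>.\<close>
  define p where "p x = snd (S' x)" for x
  define j where "j h = S (0, h)" for h
  have "contraction C" unfolding C_def contraction_def using C0 C1 by blast
  moreover have p: "bounded_clinear p"
    unfolding p_def[abs_def] by (intro bounded_clinear_compose[OF bounded_clinear_snd] S')
  moreover have "bounded_clinear j"
    unfolding j_def[abs_def] by (intro bounded_clinear_compose[OF S] bounded_clinear_Pair
        bounded_clinear_zero bounded_clinear_ident)
  then have "bounded_linear j" by (simp add: bounded_clinear_iff)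
  moreover have "p (j h) = h" for h by (simp add: p_def j_def inv')
  moreover have "p (C m) = V (p m)" for m
    by (simp add: p_def C_def inv' opR_def split: prod.split)
  ultimately obtain r s where r: "bounded_clinear r" and p_r: "\<And>y. p (r y) = y" and s: "s \<ge> 0"
    and bound: "\<And>N y. (\<And>n. n < N \<Longrightarrow> Vs (y n) = 0) \<Longrightarrow>
      norm (\<Sum>n<N. (C ^^ n) (r (y n))) \<le> s * sqrt (\<Sum>n<N. (norm (y n))\<^sup>2)"
    using clinear_square_summable_lifting[OF sh Vs_i] by blast
  define l where "l y = fst (S' (r y))" for y
  have S'_r: "S' (r y) = (l y, y)" for y
    using p_r[of y] by (simp add: l_def p_def prod_eq_iff)
  have l: "bounded_clinear l"
    unfolding l_def[abs_def]
    by (intro bounded_clinear_compose[OF bounded_clinear_fst] bounded_clinear_compose[OF S'] r)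
  have S'_C: "S' ((C ^^ n) x) = (opR T V X ^^ n) (S' x)" for n x
    by (induction n) (simp_all add: C_def inv')
  obtain K where K: "\<And>x. norm (S' x) \<le> norm x * K" and "K > 0"
    using bounded_linear.pos_bounded[of S'] S' by (auto simp: bounded_clinear_iff)
  obtain K' where K': "\<And>x. norm (l x) \<le> norm x * K'" and "K' > 0"
    using bounded_linear.pos_bounded[of l] l by (auto simp: bounded_clinear_iff)
  have norm_fst: "norm (fst z) \<le> norm z" for z :: "'k \<times> 'h"
    using norm_fst_le[of "fst z" "snd z"] by simp
  define A where "A h = X h + T (l (defect h))" for h
  have "bounded_clinear defect"
    unfolding defect_def[abs_def] using Vs Vs_i
    by (intro bounded_clinear_diff bounded_clinear_ident bounded_clinear_compose[OF V'])
      (simp add: bounded_clinear_iff)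
  then have "bounded_clinear A"
    unfolding A_def[abs_def]
    by (intro bounded_clinear_add X bounded_clinear_compose[OF T] bounded_clinear_compose[OF l])
  moreover have A_V: "A (V h) = X (V h)" for h
    by (simp add: A_def T.zero bounded_clinear_0[OF l])
  moreover have "norm (\<Sum>n<N. corner T V A n (y n)) \<le> (s * K + K') * sqrt (\<Sum>n<N. (norm (y n))\<^sup>2)"
    if ker: "\<And>n. n < N \<Longrightarrow> Vs (y n) = 0" for N y
  proof (cases N)
    case (Suc M)
    let ?q = "sqrt (\<Sum>n<N. (norm (y n))\<^sup>2)"
    \<comment> \<open>False at index 0, where the corners are 0 but \<open>l z\<close> need not be.
      From index 1 on, \<open>A_V\<close> makes both sides obey the same recursion.\<close>
    have Suc_corner: "corner T V A (Suc n) z = (T ^^ Suc n) (l z) + corner T V X (Suc n) z"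
      if "Vs z = 0" for n z
    proof (induction n)
      case 0
      then show ?case by (simp add: A_def defect_kernel[OF that] T.zero add.commute)
    next
      case (Suc n)
      then show ?case by (simp add: A_V T.add add.assoc)
    qed
    \<comment> \<open>The subtracted term corrects index 0 and accounts for \<open>K'\<close> in the
      constant.\<close>
    have "corner T V A n (y n) = fst (S' ((C ^^ n) (r (y n)))) - (if n = 0 then l (y n) else 0)"
      if "n < N" for n
      using Suc_corner[OF ker[OF that]]
      unfolding S'_C S'_r opR_funpow[OF T_lin] by (cases n) simp_all
    then have "(\<Sum>n<N. corner T V A n (y n)) =
        (\<Sum>n<N. fst (S' ((C ^^ n) (r (y n)))) - (if n = 0 then l (y n) else 0))"
      by simp
    also have "\<dots> = fst (S' (\<Sum>n<N. (C ^^ n) (r (y n)))) - l (y 0)"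
      using S' by (simp add: sum_subtractf Suc fst_sum bounded_clinear_iff
          linear_sum[OF bounded_linear.linear] del: sum.lessThan_Suc)
    also have "norm \<dots> \<le> norm (\<Sum>n<N. (C ^^ n) (r (y n))) * K + norm (y 0) * K'"
      by (intro order_trans[OF norm_triangle_ineq4] add_mono K' order_trans[OF norm_fst K])
    also have "\<dots> \<le> s * ?q * K + ?q * K'"
    proof (intro add_mono mult_right_mono)
      show "norm (\<Sum>n<N. (C ^^ n) (r (y n))) \<le> s * ?q" by (rule bound[OF ker])
      have "(norm (y 0))\<^sup>2 \<le> (\<Sum>n<N. (norm (y n))\<^sup>2)"
        using Suc by (intro member_le_sum) auto
      then show "norm (y 0) \<le> ?q" by (rule real_le_rsqrt)
    qed (use \<open>K > 0\<close> \<open>K' > 0\<close> in auto)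
    finally show ?thesis by (simp add: algebra_simps)
  qed simp
  ultimately show thesis by (rule that)
qed

section \<open>The equivalence of similarity and quadratic nearness\<close>

theorem theorem5p4:
  fixes T :: "'k::complex_hilbert \<Rightarrow> 'k"
    and V :: "'h::complex_hilbert \<Rightarrow> 'h"
    and X :: "'h \<Rightarrow> 'k"
  assumes "pure_isometry V"
    and "contraction T"
    and "right_invertible T"
    and "bounded_clinear X"
  shows "similar_to_contraction (opR T V X) \<longleftrightarrow>
    (\<exists>A E. bounded_clinear A \<and> bounded_clinear_sum E \<and> nilpotent E \<and>
       E \<circ> opR T V A = (\<lambda>_. 0) \<and> opR T V X = (\<lambda>z. opR T V A z + E z) \<and>
       (\<exists>s::real. \<forall>(N::nat) (x::nat \<Rightarrow> 'k \<times> 'h).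
          (\<forall>n\<le>N. x n \<in> {0} \<times> {y. cadjoint V y = 0}) \<longrightarrow>
          norm (\<Sum>n\<le>N. (opR T V A ^^ n) (x n) - (opR T V (\<lambda>_. 0) ^^ n) (x n))
            \<le> s * sqrt (\<Sum>n\<le>N. (norm (x n))\<^sup>2)))"
    (is "_ \<longleftrightarrow> (\<exists>A E. ?P A E)")
proof -
  obtain Vs where sh: "shift V Vs" and cadj: "cadjoint V = Vs"
    and Vs_i: "\<And>x. Vs (scaleC \<i> x) = scaleC \<i> (Vs x)"
    using pure_isometry_shift[OF assms(1)] by blast
  interpret shift V Vs by (rule sh)
  have V': "bounded_clinear V" and V_contr: "contraction V"
    using assms(1) by (auto simp: pure_isometry_def isometry_def contraction_def)
  have T': "bounded_clinear T" using assms(2) by (simp add: contraction_def)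
  then have T_lin: "bounded_linear T" by (simp add: bounded_clinear_iff)
  interpret T: bounded_linear T by (rule T_lin)
  have sum_eq: "(\<Sum>n\<le>N. (opR T V A ^^ n) (x n) - (opR T V (\<lambda>_. 0) ^^ n) (x n))
      = (\<Sum>n\<le>N. corner T V A n (snd (x n)), 0)"
    if "\<forall>n\<le>N. fst (x n) = 0" for N A and x :: "nat \<Rightarrow> 'k \<times> 'h"
  proof -
    have "(opR T V A ^^ n) (x n) - (opR T V (\<lambda>_. 0) ^^ n) (x n) = (corner T V A n (snd (x n)), 0)"
      if "n \<le> N" for n
      using opR_funpow_diff[OF T_lin, where V=V and Y=A and n=n and h="snd (x n)"] \<open>\<forall>n\<le>N. fst (x n) = 0\<close> that
      by (metis prod.collapse)
    then show ?thesis by (simp add: prod_eq_iff fst_sum snd_sum)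
  qed
  show ?thesis
  proof
    assume "similar_to_contraction (opR T V X)"
    then obtain A s where A: "bounded_clinear A" and A_V: "\<And>h. A (V h) = X (V h)"
      and bound: "\<And>N y. (\<And>n. n < N \<Longrightarrow> Vs (y n) = 0) \<Longrightarrow>
        norm (\<Sum>n<N. corner T V A n (y n)) \<le> s * sqrt (\<Sum>n<N. (norm (y n))\<^sup>2)"
      using quadratically_near_perturbation[OF sh Vs_i V' T' assms(4)] by blast
    \<comment> \<open>The difference of the corners: \<open>E\<close> maps into the first summand
      and vanishes there, so its square is 0, and it kills the range of \<open>opR T V A\<close> by
      \<open>A_V\<close>.\<close>
    define E :: "'k \<times> 'h \<Rightarrow> 'k \<times> 'h" where "E = (\<lambda>z. (X (snd z) - A (snd z), 0))"
    have "bounded_clinear E"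
      unfolding E_def by (intro bounded_clinear_Pair bounded_clinear_diff bounded_clinear_zero
          bounded_clinear_compose[OF A bounded_clinear_snd]
          bounded_clinear_compose[OF assms(4) bounded_clinear_snd])
    moreover have "X 0 = 0" "A 0 = 0"
      using A assms(4) by (simp_all add: bounded_clinear_0)
    then have "nilpotent E"
      unfolding nilpotent_def by (intro exI[of _ 2]) (auto simp: E_def numeral_2_eq_2 zero_prod_def)
    moreover have "E \<circ> opR T V A = (\<lambda>_. 0)"
      by (auto simp: E_def opR_def A_V zero_prod_def)
    moreover have "opR T V X = (\<lambda>z. opR T V A z + E z)"
      by (auto simp: E_def opR_def)
    moreover have "norm (\<Sum>n\<le>N. (opR T V A ^^ n) (x n) - (opR T V (\<lambda>_. 0) ^^ n) (x n))
            \<le> s * sqrt (\<Sum>n\<le>N. (norm (x n))\<^sup>2)"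
      if x: "\<forall>n\<le>N. x n \<in> {0} \<times> {y. cadjoint V y = 0}" for N and x :: "nat \<Rightarrow> 'k \<times> 'h"
    proof -
      have fst: "\<forall>n\<le>N. fst (x n) = 0" and "\<And>n. n \<le> N \<Longrightarrow> Vs (snd (x n)) = 0"
        using x by (auto simp: cadj)
      then have "norm (\<Sum>n\<le>N. corner T V A n (snd (x n))) \<le> s * sqrt (\<Sum>n\<le>N. (norm (snd (x n)))\<^sup>2)"
        using bound[of "Suc N" "\<lambda>n. snd (x n)"] by (simp only: lessThan_Suc_atMost less_Suc_eq_le)
      moreover have "(\<Sum>n\<le>N. (norm (snd (x n)))\<^sup>2) = (\<Sum>n\<le>N. (norm (x n))\<^sup>2)"
        using fst by (intro sum.cong) (auto simp: norm_prod_def)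
      ultimately show ?thesis by (simp add: sum_eq[OF fst] norm_Pair)
    qed
    ultimately show "\<exists>A E. ?P A E"
      using A unfolding bounded_clinear_sum_iff by blast
  next
    assume "\<exists>A E. ?P A E"
    then obtain A E s where A: "bounded_clinear A" and EA: "E \<circ> opR T V A = (\<lambda>_. 0)"
      and XE: "opR T V X = (\<lambda>z. opR T V A z + E z)"
      and near: "\<And>N (x::nat \<Rightarrow> 'k \<times> 'h). (\<forall>n\<le>N. x n \<in> {0} \<times> {y. cadjoint V y = 0}) \<Longrightarrow>
          norm (\<Sum>n\<le>N. (opR T V A ^^ n) (x n) - (opR T V (\<lambda>_. 0) ^^ n) (x n))
            \<le> s * sqrt (\<Sum>n\<le>N. (norm (x n))\<^sup>2)"
      by blast
    \<comment> \<open>\<open>E\<close> vanishes at \<open>opR T V A (0, h) = (A h, V h)\<close>, so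
      the two triangular operators agree there; their first coordinates share the summand
      \<open>T (A h)\<close>.\<close>
    have XA_V: "X (V h) = A (V h)" for h
      using fun_cong[OF EA, of "(0, h)"] fun_cong[OF XE, of "opR T V A (0, h)"]
      by (simp add: opR_def)
    \<comment> \<open>The maximum covers a negative \<open>s\<close>, as the intertwiner lemma takes
      a nonnegative constant.\<close>
    have "norm (\<Sum>n<N. corner T V A n (y n)) \<le> max s 0 * sqrt (\<Sum>n<N. (norm (y n))\<^sup>2)"
      if ker: "\<And>n. n < N \<Longrightarrow> Vs (y n) = 0" for N y
    proof (cases N)
      case (Suc M)
      let ?x = "\<lambda>n. (0, y n) :: 'k \<times> 'h"
      have "\<forall>n\<le>M. ?x n \<in> {0} \<times> {y. cadjoint V y = 0}"
        using ker Suc by (auto simp: cadj)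
      from near[OF this]
      have "norm (\<Sum>n<N. corner T V A n (y n)) \<le> s * sqrt (\<Sum>n<N. (norm (y n))\<^sup>2)"
        unfolding Suc lessThan_Suc_atMost by (subst (asm) sum_eq) (simp_all add: norm_Pair)
      also have "\<dots> \<le> max s 0 * sqrt (\<Sum>n<N. (norm (y n))\<^sup>2)"
        by (intro mult_right_mono) (simp_all add: sum_nonneg)
      finally show ?thesis .
    qed simp
    then obtain L0 where L0: "bounded_linear L0" and L0_V: "\<And>h. L0 (V h) = T (L0 h) + A h"
      using intertwiner_of_square_bounded[OF T_lin, of A "corner T V A" "max s 0"] A
      by (auto simp: bounded_clinear_iff)
    define L where "L = clinear_part L0"
    have L: "bounded_clinear L" unfolding L_def by (rule bounded_clinear_clinear_part[OF L0])
    have L_V: "L (V h) = T (L h) + A h" for h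
    proof -
      have "L (V h) = clinear_part (\<lambda>h. T (L0 h) + A h) h"
        unfolding L_def L0_V[symmetric] by (rule clinear_part_comp_right[OF V', symmetric])
      then show ?thesis
        by (simp add: clinear_part_add clinear_part_comp_left[OF T'] clinear_part_of_clinear[OF A] L_def)
    qed
    obtain S where S: "bounded_clinear S" and TS: "\<And>x. T (S x) = x"
      using assms(3) unfolding right_invertible_def by (auto simp: fun_eq_iff)
    \<comment> \<open>The correction vanishes on the range of \<open>V\<close> by
      \<open>XA_V\<close>, while \<open>T\<close> turns it into \<open>X h - A h\<close>; this
      replaces \<open>A\<close> by \<open>X\<close> in the equation for \<open>L\<close>.\<close>
    define L' where "L' h = L h - S (X h - A h)" for h
    have S_0: "S 0 = 0" using S by (rule bounded_clinear_0)
    have "bounded_clinear L'"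
      unfolding L'_def[abs_def]
      by (intro bounded_clinear_diff L bounded_clinear_compose[OF S] assms(4) A)
    moreover have "L' (V h) = T (L' h) + X h" for h
      by (simp add: L'_def XA_V S_0 L_V T.diff TS)
    ultimately show "similar_to_contraction (opR T V X)"
      by (rule opR_similar_to_contraction[OF assms(2) V_contr])
  qed
qed

end
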